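(* Let $\lambda = 2\cos(\pi/5)$, let $(\tau)$ be a nontrivial ideal of $\mathbb{Z}[\lambda]$, and let $N(G_0(\tau))$ be the normaliser of $G_0(\tau)$ in $PSL_2(\mathbb{R})$. Then $$N(G_0(\tau)) = G_0(\tau/h),$$ where $h$ is the largest divisor of $4$ such that $h^2$ divides $\tau$. Further, the quotient group $N(G_0(\tau))/G_0(\tau)$ is (isomorphic to) the trivial group $1$ if $h=1$, $\mathbb{Z}_2\times\mathbb{Z}_2$ if $h=2$, and $\mathbb{Z}_4\times\mathbb{Z}_4$ if $h=4$.
   Context: Here $\lambda = 2\cos(\pi/5)$, so $\lambda^2=\lambda+1$; $\mathbb{Z}[\lambda]$ is a principal ideal domain in which $2$ is prime. $G_5\subset PSL_2(\mathbb{R})$ is the Hecke group associated to $\lambda$, i.e. the group generated by (the classes of) $\begin{pmatrix}0&-1\\1&0\end{pmatrix}$ and $\begin{pmatrix}1&\lambda\\0&1\end{pmatrix}$; its elements are represented, up to sign, by matrices with entries in $\mathbb{Z}[\lambda]$. For $\tau\in\mathbb{Z}[\lambda]$, $G_0(\tau)$ is the subgroup of those elements of $G_5$ whose $(2,1)$-entry is a multiple of $\tau$ in $\mathbb{Z}[\lambda]$. A nontrivial ideal means a nonzero ideal. Divisibility is in $\mathbb{Z}[\lambda]$; the divisors of $4$ are, up to units, $1,2,4$, and $h$ is taken in $\{1,2,4\}$. *)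

theory Defs
  imports
    "HOL-Analysis.Analysis"
    "HOL-Computational_Algebra.Polynomial"
    "HOL-Algebra.Zassenhaus"
    "HOL-Algebra.Generated_Groups"
    "HOL-Algebra.Elementary_Groups"
begin

section \<open>The ring \<open>\<int>[\<lambda>]\<close>\<close>

definition lam :: real where
  "lam = 2 * cos (pi / 5)"

definition Zlam :: "real set" where
  "Zlam = {poly p lam | p. \<forall>i. coeff p i \<in> \<int>}"

definition Zlam_dvd :: "real \<Rightarrow> real \<Rightarrow> bool" where
  "Zlam_dvd x y \<longleftrightarrow> (\<exists>z\<in>Zlam. y = x * z)"

lemma lam_pos: "lam > 0"
  unfolding lam_def by (simp add: cos_gt_zero)

lemma lam_squared: "lam * lam = lam + 1"
proof -
  define c where "c = cos (pi / 5)"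
  have "cos (3 * (pi / 5)) = cos (pi - 2 * (pi / 5))"
    by (rule arg_cong[where f = cos]) simp
  then have "4 * c ^ 3 - 3 * c = - (2 * c ^ 2 - 1)"
    unfolding c_def by (simp only: cos_treble_cos cos_pi_minus cos_double_cos)
  then have "(c + 1) * (4 * c\<^sup>2 - 2 * c - 1) = 0"
    by (simp add: algebra_simps power2_eq_square power3_eq_cube)
  moreover have "c > 0"
    unfolding c_def by (simp add: cos_gt_zero)
  ultimately have "4 * c\<^sup>2 - 2 * c - 1 = 0"
    by auto
  then show ?thesis
    unfolding lam_def c_def[symmetric] by (simp add: power2_eq_square)
qed

lemma Zlam_of_int: "of_int a \<in> Zlam"
  unfolding Zlam_def by (rule CollectI, rule exI[of _ "[:of_int a:]"]) (auto simp: coeff_pCons split: nat.split)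

lemma Zlam_0: "0 \<in> Zlam" and Zlam_1: "1 \<in> Zlam"
  using Zlam_of_int[of 0] Zlam_of_int[of 1] by simp_all

lemma Zlam_lam: "lam \<in> Zlam"
  unfolding Zlam_def by (rule CollectI, rule exI[of _ "[:0, 1:]"]) (auto simp: coeff_pCons split: nat.split)

lemma Zlam_add: "x \<in> Zlam \<Longrightarrow> y \<in> Zlam \<Longrightarrow> x + y \<in> Zlam"
  unfolding Zlam_def
  by clarify (metis (no_types, lifting) Ints_add coeff_add poly_add)

lemma Zlam_minus: "x \<in> Zlam \<Longrightarrow> - x \<in> Zlam"
  unfolding Zlam_def
  by clarify (metis (no_types, lifting) Ints_minus coeff_minus poly_minus)

lemma Zlam_mult:
  assumes "x \<in> Zlam" "y \<in> Zlam"
  shows "x * y \<in> Zlam"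
proof -
  obtain p q where pq: "x = poly p lam" "\<forall>i. coeff p i \<in> \<int>" "y = poly q lam" "\<forall>i. coeff q i \<in> \<int>"
    using assms unfolding Zlam_def by auto
  have "\<forall>i. coeff (p * q) i \<in> \<int>"
    using pq by (auto simp: coeff_mult intro!: Ints_sum Ints_mult)
  then show ?thesis
    unfolding Zlam_def using pq by (intro CollectI exI[of _ "p * q"]) simp
qed

lemma Zlam_eq: "Zlam = {of_int a + of_int b * lam | a b. True}" (is "_ = ?R")
proof
  show "?R \<subseteq> Zlam"
    using Zlam_of_int Zlam_lam by (auto intro!: Zlam_add Zlam_mult)
  have "(\<forall>i. coeff p i \<in> \<int>) \<longrightarrow> poly p lam \<in> ?R" for p
  proof (induction p)
    case 0
    show ?case by (auto intro!: exI[of _ "0::int"])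
  next
    case (pCons c p)
    show ?case
    proof
      assume *: "\<forall>i. coeff (pCons c p) i \<in> \<int>"
      then have "c \<in> \<int>" by (metis coeff_pCons_0)
      then obtain k where k: "c = of_int k" by (auto elim: Ints_cases)
      have "\<forall>i. coeff p i \<in> \<int>" using * by (metis coeff_pCons_Suc)
      then obtain a b where ab: "poly p lam = of_int a + of_int b * lam"
        using pCons.IH by auto
      have "poly (pCons c p) lam = of_int k + of_int a * lam + of_int b * (lam * lam)"
        by (simp add: k ab algebra_simps)
      also have "\<dots> = of_int (k + b) + of_int (a + b) * lam"
        by (simp add: lam_squared algebra_simps)
      finally show "poly (pCons c p) lam \<in> ?R" by blast
    qed
  qed
  then show "Zlam \<subseteq> ?R" unfolding Zlam_def by auto
qed

section \<open>The groups \<open>SL\<^sub>2(\<real>)\<close> and \<open>PSL\<^sub>2(\<real>)\<close>\<close>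

definition SL2R :: "(real^2^2) monoid" where
  "SL2R = \<lparr>carrier = {A. det A = 1}, monoid.mult = (**), one = mat 1\<rparr>"

definition PSL2R :: "(real^2^2) set monoid" where
  "PSL2R = SL2R Mod {mat 1, - mat 1}"

definition psl_class :: "real^2^2 \<Rightarrow> (real^2^2) set" where
  "psl_class A = {mat 1, - mat 1} #>\<^bsub>SL2R\<^esub> A"

definition mat2 :: "real \<Rightarrow> real \<Rightarrow> real \<Rightarrow> real \<Rightarrow> real^2^2" where
  "mat2 a b c d = vector [vector [a, b], vector [c, d]]"

lemma mat2_nth [simp]:
  "mat2 a b c d $ 1 $ 1 = a" "mat2 a b c d $ 1 $ 2 = b"
  "mat2 a b c d $ 2 $ 1 = c" "mat2 a b c d $ 2 $ 2 = d"
  by (simp_all add: mat2_def)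

lemma matmul_minus_left: "(- A) ** B = - (A ** B)" for A B :: "real^2^2"
  by (simp add: vec_eq_iff matrix_matrix_mult_def forall_2 sum_2)

lemma matmul_minus_right: "A ** (- B) = - (A ** B)" for A B :: "real^2^2"
  by (simp add: vec_eq_iff matrix_matrix_mult_def forall_2 sum_2)

lemma psl_class_eq: "psl_class A = {A, - A}"
  by (simp add: psl_class_def r_coset_def SL2R_def matmul_minus_left insert_commute)

lemma det_uminus_2: "det (- A) = det A" for A :: "real^2^2"
  by (simp add: det_2)

definition adj2 :: "real^2^2 \<Rightarrow> real^2^2" where
  "adj2 A = mat2 (A$2$2) (- A$1$2) (- A$2$1) (A$1$1)"

lemma adj2: "det A = 1 \<Longrightarrow> adj2 A ** A = mat 1"
  by (auto simp: adj2_def vec_eq_iff matrix_matrix_mult_def forall_2 sum_2 det_2 mat_def algebra_simps)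

lemma adj2_right: "det A = 1 \<Longrightarrow> A ** adj2 A = mat 1"
  by (auto simp: adj2_def vec_eq_iff matrix_matrix_mult_def forall_2 sum_2 det_2 mat_def algebra_simps)

lemma det_adj2: "det (adj2 A) = det A"
  by (simp add: adj2_def det_2 mult.commute)

lemma SL2R_simps [simp]:
  "carrier SL2R = {A. det A = 1}" "monoid.mult SL2R = (**)" "one SL2R = mat 1"
  by (simp_all add: SL2R_def)

lemma group_SL2R: "group SL2R"
proof (rule groupI)
  fix A assume "A \<in> carrier SL2R"
  then show "\<exists>B\<in>carrier SL2R. B \<otimes>\<^bsub>SL2R\<^esub> A = \<one>\<^bsub>SL2R\<^esub>"
    by (intro bexI[of _ "adj2 A"]) (simp_all add: adj2 det_adj2)
qed (simp_all add: det_mul matrix_mul_assoc)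

lemma inv_SL2R: "det A = 1 \<Longrightarrow> inv\<^bsub>SL2R\<^esub> A = adj2 A"
  by (rule group.inv_equality[OF group_SL2R]) (simp_all add: adj2 det_adj2)

lemma normal_pm_one: "{mat 1, - mat 1} \<lhd> SL2R"
proof (rule group.normalI[OF group_SL2R])
  show "subgroup {mat 1, - mat 1} SL2R"
  proof (rule group.subgroupI[OF group_SL2R])
    have "adj2 (mat 1) = mat 1" "adj2 (- mat 1) = - mat 1"
      by (simp_all add: adj2_def vec_eq_iff forall_2 mat_def)
    then show "inv\<^bsub>SL2R\<^esub> A \<in> {mat 1, - mat 1}" if "A \<in> {mat 1, - mat 1}" for A
      using that inv_SL2R[of "mat 1"] inv_SL2R[of "- mat 1"] by (auto simp: det_uminus_2)
  qed (auto simp: det_uminus_2 matmul_minus_left)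
  show "\<forall>A\<in>carrier SL2R. {mat 1, - mat 1} #>\<^bsub>SL2R\<^esub> A = A <#\<^bsub>SL2R\<^esub> {mat 1, - mat 1}"
    by (auto simp: r_coset_def l_coset_def matmul_minus_left matmul_minus_right)
qed

lemma group_PSL2R: "group PSL2R"
  unfolding PSL2R_def by (rule normal.factorgroup_is_group[OF normal_pm_one])

lemma carrier_PSL2R: "carrier PSL2R = {psl_class A | A. det A = 1}"
  by (auto simp: PSL2R_def FactGroup_def RCOSETS_def psl_class_def)

lemma psl_class_mult:
  assumes "det A = 1" "det B = 1"
  shows "psl_class A \<otimes>\<^bsub>PSL2R\<^esub> psl_class B = psl_class (A ** B)"
  using normal.rcos_sum[OF normal_pm_one, of A B] assms by (simp add: PSL2R_def psl_class_def)

lemma psl_class_one: "\<one>\<^bsub>PSL2R\<^esub> = psl_class (mat 1)"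
  by (simp add: PSL2R_def psl_class_eq)

lemma psl_class_inv:
  assumes "det A = 1"
  shows "inv\<^bsub>PSL2R\<^esub> psl_class A = psl_class (adj2 A)"
  using assms
  by (intro group.inv_equality[OF group_PSL2R])
     (auto simp: carrier_PSL2R psl_class_mult det_adj2 adj2 psl_class_one)

section \<open>The Hecke group and its congruence subgroups\<close>

definition hecke_group :: "(real^2^2) set set" where
  "hecke_group = generate PSL2R {psl_class (mat2 0 (-1) 1 0), psl_class (mat2 1 lam 0 1)}"

text \<open>The entries of an element of \<open>PSL\<^sub>2(\<real>)\<close> are defined up to a common sign, so the
  condition on the \<open>(2,1)\<close>-entry does not depend on the representing matrix.\<close>

definition G0 :: "real \<Rightarrow> (real^2^2) set set" where
  "G0 \<tau> = {X \<in> hecke_group. \<exists>A\<in>X. Zlam_dvd \<tau> (A $ 2 $ 1)}"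

definition largest_h :: "real \<Rightarrow> nat" where
  "largest_h \<tau> = Max {h. h dvd 4 \<and> Zlam_dvd ((of_nat h)\<^sup>2) \<tau>}"

definition normalizer_quotient :: "real \<Rightarrow> (real^2^2) set set monoid" where
  "normalizer_quotient \<tau> = (PSL2R\<lparr>carrier := normalizer PSL2R (G0 \<tau>)\<rparr>) Mod (G0 \<tau>)"

lemma hecke_generators_carrier:
  "{psl_class (mat2 0 (-1) 1 0), psl_class (mat2 1 lam 0 1)} \<subseteq> carrier PSL2R"
  by (auto simp: carrier_PSL2R det_2 intro: exI[of _ "mat2 0 (-1) 1 0"] exI[of _ "mat2 1 lam 0 1"])

lemma subgroup_hecke_group: "subgroup hecke_group PSL2R"
  unfolding hecke_group_def
  by (rule group.generate_is_subgroup[OF group_PSL2R hecke_generators_carrier])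

definition Zlam_mat :: "real^2^2 \<Rightarrow> bool" where
  "Zlam_mat A \<longleftrightarrow> det A = 1 \<and> (\<forall>i j. A $ i $ j \<in> Zlam)"

lemma Zlam_mat_mult: "Zlam_mat A \<Longrightarrow> Zlam_mat B \<Longrightarrow> Zlam_mat (A ** B)"
  unfolding Zlam_mat_def det_mul
  by (auto simp: matrix_matrix_mult_def sum_2 intro!: Zlam_add Zlam_mult)

lemma Zlam_mat_adj2: "Zlam_mat A \<Longrightarrow> Zlam_mat (adj2 A)"
  unfolding Zlam_mat_def det_adj2 by (auto simp: forall_2 adj2_def intro!: Zlam_minus)

lemma hecke_group_Zlam:
  assumes "X \<in> hecke_group"
  shows "\<exists>A. Zlam_mat A \<and> X = psl_class A"
  using assms unfolding hecke_group_def
proof (induction rule: generate.induct)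
  case one
  show ?case
    by (intro exI[of _ "mat 1"]) (auto simp: psl_class_one Zlam_mat_def mat_def Zlam_0 Zlam_1 det_2)
next
  case (incl X)
  then show ?case
    by (auto simp: Zlam_mat_def det_2 forall_2 Zlam_0 Zlam_1 Zlam_lam Zlam_minus
        intro: exI[of _ "mat2 0 (-1) 1 0"] exI[of _ "mat2 1 lam 0 1"])
next
  case (inv X)
  then obtain A where A: "Zlam_mat A" "X = psl_class A"
    by (auto simp: Zlam_mat_def det_2 forall_2 Zlam_0 Zlam_1 Zlam_lam Zlam_minus
        dest: meta_spec[of _ "mat2 0 (-1) 1 0"] meta_spec[of _ "mat2 1 lam 0 1"])
  then show ?case
    using Zlam_mat_adj2 psl_class_inv Zlam_mat_def by metis
next
  case (eng X Y)
  then show ?case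
    using Zlam_mat_mult psl_class_mult Zlam_mat_def by metis
qed

lemma Zlam_dvd_minus: "Zlam_dvd t (- x) \<longleftrightarrow> Zlam_dvd t x"
  unfolding Zlam_dvd_def using Zlam_minus by (metis minus_minus mult_minus_right)

lemma Zlam_dvd_add: "Zlam_dvd t x \<Longrightarrow> Zlam_dvd t y \<Longrightarrow> Zlam_dvd t (x + y)"
  unfolding Zlam_dvd_def using Zlam_add by (metis distrib_left)

lemma Zlam_dvd_mult: "Zlam_dvd t x \<Longrightarrow> y \<in> Zlam \<Longrightarrow> Zlam_dvd t (x * y)"
  unfolding Zlam_dvd_def using Zlam_mult by (metis mult.assoc)

lemma psl_class_in_G0:
  "psl_class A \<in> G0 \<tau> \<longleftrightarrow> psl_class A \<in> hecke_group \<and> Zlam_dvd \<tau> (A $ 2 $ 1)"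
  by (auto simp: G0_def psl_class_eq Zlam_dvd_minus)

lemma G0_E:
  assumes "X \<in> G0 \<tau>"
  obtains A where "Zlam_mat A" "X = psl_class A" "Zlam_dvd \<tau> (A $ 2 $ 1)"
  using assms hecke_group_Zlam[of X] psl_class_in_G0 unfolding G0_def by blast

lemma subgroup_G0: "subgroup (G0 \<tau>) PSL2R"
proof (rule group.subgroupI[OF group_PSL2R])
  show "G0 \<tau> \<subseteq> carrier PSL2R"
    using subgroup.subset[OF subgroup_hecke_group] by (auto simp: G0_def)
  have "\<one>\<^bsub>PSL2R\<^esub> \<in> G0 \<tau>"
    using subgroup.one_closed[OF subgroup_hecke_group]
    by (auto simp: psl_class_one psl_class_in_G0 mat_def Zlam_dvd_def Zlam_0 intro: bexI[of _ 0])
  then show "G0 \<tau> \<noteq> {}" by auto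
next
  fix X assume X: "X \<in> G0 \<tau>"
  then obtain A where A: "Zlam_mat A" "X = psl_class A" "Zlam_dvd \<tau> (A $ 2 $ 1)"
    by (rule G0_E)
  have "inv\<^bsub>PSL2R\<^esub> X \<in> hecke_group"
    using X subgroup.m_inv_closed[OF subgroup_hecke_group] by (auto simp: G0_def)
  then show "inv\<^bsub>PSL2R\<^esub> X \<in> G0 \<tau>"
    using A by (simp add: psl_class_inv Zlam_mat_def psl_class_in_G0 adj2_def Zlam_dvd_minus)
next
  fix X Y assume XY: "X \<in> G0 \<tau>" "Y \<in> G0 \<tau>"
  obtain A where A: "Zlam_mat A" "X = psl_class A" "Zlam_dvd \<tau> (A $ 2 $ 1)"
    using XY(1) by (rule G0_E)
  obtain B where B: "Zlam_mat B" "Y = psl_class B" "Zlam_dvd \<tau> (B $ 2 $ 1)"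
    using XY(2) by (rule G0_E)
  have "X \<otimes>\<^bsub>PSL2R\<^esub> Y \<in> hecke_group"
    using XY subgroup.m_closed[OF subgroup_hecke_group] by (auto simp: G0_def)
  moreover have "Zlam_dvd \<tau> ((A ** B) $ 2 $ 1)"
    using A B Zlam_dvd_mult[of \<tau> "B $ 2 $ 1" "A $ 2 $ 2"]
      Zlam_dvd_mult[of \<tau> "A $ 2 $ 1" "B $ 1 $ 1"]
    by (simp add: matrix_matrix_mult_def sum_2 Zlam_mat_def mult.commute Zlam_dvd_add)
  ultimately show "X \<otimes>\<^bsub>PSL2R\<^esub> Y \<in> G0 \<tau>"
    using A B by (simp add: psl_class_mult Zlam_mat_def psl_class_in_G0)
qed

lemma G0_normal_in_normalizer:
  "G0 \<tau> \<lhd> PSL2R\<lparr>carrier := normalizer PSL2R (G0 \<tau>)\<rparr>"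
  by (rule group.subgroup_in_normalizer[OF group_PSL2R subgroup_G0])

end

theory Submission
  imports Defs
begin

text \<open>Two facts about the Hecke group are proved by elementary means: vectors in the orbit of \<open>(1, 0)\<close> in the
  first quadrant are generated by four nonnegative matrices, and every vector over \<open>\<int>[\<lambda>]\<close> is a multiple
  of an orbit vector (Leutbecher). A matrix \<open>M\<close> normalising \<open>G\<^sub>0(\<tau>)\<close> therefore maps each orbit vector to
  \<open>k\<close> times an orbit vector with \<open>k\<^sup>2\<close> rational. Up to \<open>G\<^sub>5\<close>, \<open>M\<close> is upper triangular, and if it were
  not a power of \<open>T\<close>, conjugates of powers of \<open>T\<close> and products with them would give a translation by \<open>\<lambda>/n\<close> with \<open>n > 1\<close>
  of the same kind; then \<open>(\<lambda>, n)\<close> would lie in the orbit, as the square of a unit of \<open>\<int>[\<lambda>]\<close> is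
  rational only for \<open>\<plusminus> 1\<close>, and this is not the case. So \<open>M\<close> lies in \<open>G\<^sub>5\<close>. Conjugating \<open>T\<close> and one further
  element of \<open>G\<^sub>0(\<tau>)\<close> gives \<open>\<tau> | r\<^sup>2\<close> and \<open>\<tau> | 4 r\<close> for its lower left entry \<open>r\<close>, hence
  \<open>\<tau> | h r\<close>. Conversely, \<open>G\<^sub>0(\<tau>/h)\<close> normalises \<open>G\<^sub>0(\<tau>)\<close> because the diagonal entries of elements of
  \<open>G\<^sub>0(\<tau>)\<close> are congruent modulo \<open>h\<close>, which holds because \<open>G\<^sub>5\<close> is dihedral modulo \<open>2\<close>.\<close>

section \<open>Arithmetic of \<open>\<int>[\<lambda>]\<close>\<close>

lemma lam_gt_1: "lam > 1"
proof (rule ccontr)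
  assume "\<not> lam > 1"
  then have "lam * lam \<le> lam * 1"
    using lam_pos by (intro mult_left_mono) auto
  then show False using lam_squared by simp
qed

lemma lam_lam_mult: "lam * (lam * x) = lam * x + x"
  using lam_squared by (simp add: mult.assoc[symmetric] distrib_right)

lemmas lam_simps = algebra_simps lam_squared lam_lam_mult

text \<open>Infinite descent: the form is the norm of \<open>a + b * lam\<close> and has no
  nontrivial zero modulo 2, so a zero has even coordinates and can be halved.\<close>

lemma norm_form_nonzero:
  fixes a b :: int
  assumes "a * a + a * b - b * b = 0"
  shows "a = 0 \<and> b = 0"
  using assms
proof (induction "nat (\<bar>a\<bar> + \<bar>b\<bar>)" arbitrary: a b rule: less_induct)
  case less
  have "even (a * a + a * b - b * b)" using less.prems by simp
  then have "even a" "even b" by (auto simp: even_add even_mult_iff)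
  then obtain c d where cd: "a = 2 * c" "b = 2 * d" by (auto elim!: evenE)
  have "c * c + c * d - d * d = 0"
    using less.prems unfolding cd by (simp add: algebra_simps)
  show ?case
  proof (cases "a = 0 \<and> b = 0")
    case False
    then have "nat (\<bar>c\<bar> + \<bar>d\<bar>) < nat (\<bar>a\<bar> + \<bar>b\<bar>)" using cd by auto
    from less.hyps[OF this \<open>c * c + c * d - d * d = 0\<close>] show ?thesis using cd by simp
  qed
qed

text \<open>Multiplication by the conjugate produces the norm form.\<close>

lemma lam_indep:
  fixes a b :: int
  assumes "of_int a + of_int b * lam = 0"
  shows "a = 0 \<and> b = 0"
proof -
  have "of_int (a * a + a * b - b * b)
      = (of_int a + of_int b * lam) * (of_int a + of_int b * (1 - lam))"
    by (simp add: lam_simps)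
  also have "\<dots> = 0" unfolding assms by simp
  finally have "of_int (a * a + a * b - b * b) = (0::real)" .
  then show ?thesis by (intro norm_form_nonzero) (simp only: of_int_eq_0_iff)
qed

lemma lam_coords_unique:
  fixes a b c d :: int
  assumes "of_int a + of_int b * lam = of_int c + of_int d * lam"
  shows "a = c \<and> b = d"
  using lam_indep[of "a - c" "b - d"] assms by (simp add: algebra_simps)

section \<open>Coordinates, conjugation and norm\<close>

definition coords :: "real \<Rightarrow> int \<times> int" where
  "coords x = (SOME p. x = of_int (fst p) + of_int (snd p) * lam)"

lemma coords_eq [simp]: "coords (of_int a + of_int b * lam) = (a, b)"
proof -
  have "of_int a + of_int b * lam = of_int (fst (coords (of_int a + of_int b * lam)))
      + of_int (snd (coords (of_int a + of_int b * lam))) * lam"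
    unfolding coords_def by (rule someI[of _ "(a, b)"]) simp
  from lam_coords_unique[OF this] show ?thesis by (simp add: prod_eq_iff)
qed

lemma Zlam_cases:
  assumes "x \<in> Zlam"
  obtains a b :: int where "x = of_int a + of_int b * lam"
  using assms unfolding Zlam_eq by auto

text \<open>The nontrivial automorphism of the ring: \<open>1 - lam\<close> is the other root of x^2
  = x + 1. Outside \<open>Zlam\<close> the value rests on the arbitrary choice in
  \<open>coords\<close>.\<close>

definition cj :: "real \<Rightarrow> real" where
  "cj x = of_int (fst (coords x)) + of_int (snd (coords x)) * (1 - lam)"

lemma cj_eq: "cj (of_int a + of_int b * lam) = of_int a + of_int b * (1 - lam)"
  by (simp add: cj_def)

lemma cj_of_int [simp]: "cj (of_int a) = of_int a"
  using cj_eq[of a 0] by simp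

lemma cj_lam [simp]: "cj lam = 1 - lam"
  using cj_eq[of 0 1] by simp

lemma cj_add:
  assumes "x \<in> Zlam" "y \<in> Zlam"
  shows "cj (x + y) = cj x + cj y"
proof -
  obtain a b where x: "x = of_int a + of_int b * lam" using assms(1) by (rule Zlam_cases)
  obtain c d where y: "y = of_int c + of_int d * lam" using assms(2) by (rule Zlam_cases)
  have "x + y = of_int (a + c) + of_int (b + d) * lam"
    unfolding x y by (simp add: algebra_simps)
  then show ?thesis
    unfolding x y by (simp only: cj_eq) (simp add: algebra_simps)
qed

lemma cj_mult:
  assumes "x \<in> Zlam" "y \<in> Zlam"
  shows "cj (x * y) = cj x * cj y"
proof -
  obtain a b where x: "x = of_int a + of_int b * lam" using assms(1) by (rule Zlam_cases)
  obtain c d where y: "y = of_int c + of_int d * lam" using assms(2) by (rule Zlam_cases)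
  have "x * y = of_int (a * c + b * d) + of_int (a * d + b * c + b * d) * lam"
    unfolding x y by (simp add: lam_simps)
  then have "cj (x * y) = of_int (a * c + b * d) + of_int (a * d + b * c + b * d) * (1 - lam)"
    by (simp only: cj_eq)
  also have "\<dots> = cj x * cj y"
    unfolding x y cj_eq by (simp add: lam_simps)
  finally show ?thesis .
qed

lemma cj_minus: "x \<in> Zlam \<Longrightarrow> cj (- x) = - cj x"
  using cj_mult[of "of_int (-1)" x] cj_of_int[of "-1"] Zlam_of_int[of "-1"] by simp

lemma cj_diff: "x \<in> Zlam \<Longrightarrow> y \<in> Zlam \<Longrightarrow> cj (x - y) = cj x - cj y"
  using cj_add[of x "- y"] cj_minus[of y] Zlam_minus[of y] by simp

lemma Zlam_diff: "x \<in> Zlam \<Longrightarrow> y \<in> Zlam \<Longrightarrow> x - y \<in> Zlam"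
  using Zlam_add[of x "- y"] Zlam_minus[of y] by simp

lemma Zlam_power: "x \<in> Zlam \<Longrightarrow> x ^ n \<in> Zlam"
  by (induction n) (auto intro: Zlam_1 Zlam_mult)

lemma Zlam_numeral: "numeral n \<in> Zlam"
  using Zlam_of_int[of "numeral n"] by simp

lemma Zlam_of_nat: "of_nat n \<in> Zlam"
  using Zlam_of_int[of "int n"] by simp

lemmas Zlam_intros = Zlam_0 Zlam_1 Zlam_lam Zlam_of_int Zlam_of_nat Zlam_numeral
  Zlam_add Zlam_minus Zlam_diff Zlam_mult Zlam_power

lemma cj_in_Zlam: "cj x \<in> Zlam"
  unfolding cj_def by (intro Zlam_intros)

lemma cj_norm:
  assumes "x \<in> Zlam" "x \<noteq> 0"
  obtains n :: int where "x * cj x = of_int n" "n \<noteq> 0"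
proof -
  obtain a b where x: "x = of_int a + of_int b * lam" using assms(1) by (rule Zlam_cases)
  have "x * cj x = of_int (a * a + a * b - b * b)"
    unfolding x cj_eq by (simp add: lam_simps)
  moreover have "a * a + a * b - b * b \<noteq> 0"
    using norm_form_nonzero assms(2) x by fastforce
  ultimately show thesis using that by blast
qed

text \<open>The norm is a nonzero integer. This bound feeds the descent estimates for the
  cusps.\<close>

lemma cj_norm_ge_1:
  assumes "x \<in> Zlam" "x \<noteq> 0"
  shows "\<bar>x\<bar> * \<bar>cj x\<bar> \<ge> 1"
proof -
  obtain n where n: "x * cj x = of_int n" "n \<noteq> 0"
    using assms by (rule cj_norm)
  then have "\<bar>x\<bar> * \<bar>cj x\<bar> = of_int \<bar>n\<bar>" by (metis abs_mult of_int_abs)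
  then show ?thesis using n(2) by simp
qed

lemma Zlam_Rats:
  assumes "x \<in> Zlam" "x \<in> \<rat>"
  shows "x \<in> \<int>"
proof -
  obtain a b where x: "x = of_int a + of_int b * lam" using assms(1) by (rule Zlam_cases)
  obtain m n :: int where mn: "n > 0" "x = of_int m / of_int n"
    using assms(2) by (metis Rats_cases')
  then have "of_int (n * a - m) + of_int (n * b) * lam = 0"
    using x by (simp add: field_simps)
  then have "n * b = 0" using lam_indep by blast
  then show ?thesis using x mn by simp
qed

text \<open>The squares \<open>\<lambda>\<^sup>2\<^sup>k\<close> of the other units are irrational.\<close>

lemma unit_square_rational:
  assumes "x \<in> Zlam" "y \<in> Zlam" "x * y = 1" "x\<^sup>2 \<in> \<rat>"
  shows "x = 1 \<or> x = - 1"
proof -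
  have y: "y = inverse x" using assms(3) by (metis inverse_unique)
  have "y\<^sup>2 \<in> \<rat>" using assms(4) unfolding y by (simp add: power_inverse)
  then have "x\<^sup>2 \<in> \<int>" "y\<^sup>2 \<in> \<int>"
    using assms Zlam_Rats Zlam_power by blast+
  then obtain m n :: int where mn: "x\<^sup>2 = of_int m" "y\<^sup>2 = of_int n" by (auto elim!: Ints_cases)
  have "x\<^sup>2 * y\<^sup>2 = 1" using assms(3) by (metis power_mult_distrib power_one)
  then have "m * n = 1" unfolding mn by (metis of_int_1 of_int_eq_iff of_int_mult)
  moreover have "m \<ge> 0" using mn(1) by (metis of_int_0_le_iff zero_le_power2)
  ultimately have "m = 1" using zmult_eq_1_iff by auto
  then show ?thesis using mn(1) by (simp add: power2_eq_1_iff)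
qed

subsection \<open>Divisibility\<close>

lemma Zlam_dvd_diff: "Zlam_dvd t x \<Longrightarrow> Zlam_dvd t y \<Longrightarrow> Zlam_dvd t (x - y)"
  using Zlam_dvd_add[of t x "- y"] by (simp add: Zlam_dvd_minus)

lemma Zlam_dvd_mult_left: "Zlam_dvd t x \<Longrightarrow> y \<in> Zlam \<Longrightarrow> Zlam_dvd t (y * x)"
  using Zlam_dvd_mult[of t x y] by (simp add: mult.commute)

lemma Zlam_dvd_self_mult: "y \<in> Zlam \<Longrightarrow> Zlam_dvd t (t * y)"
  unfolding Zlam_dvd_def by auto

lemma Zlam_dvd_trans: "Zlam_dvd s t \<Longrightarrow> Zlam_dvd t x \<Longrightarrow> Zlam_dvd s x"
  unfolding Zlam_dvd_def by (metis mult.assoc Zlam_mult)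

lemma Zlam_dvd_imp_Zlam: "Zlam_dvd t x \<Longrightarrow> t \<in> Zlam \<Longrightarrow> x \<in> Zlam"
  unfolding Zlam_dvd_def using Zlam_mult by auto

lemma Zlam_dvd_mult_cancel: "k \<noteq> 0 \<Longrightarrow> Zlam_dvd (k * s) (k * t) \<longleftrightarrow> Zlam_dvd s t"
  unfolding Zlam_dvd_def by (simp add: mult.assoc)

lemma Zlam_dvd_of_int_coords:
  "Zlam_dvd (of_int n) (of_int a + of_int b * lam) \<longleftrightarrow> n dvd a \<and> n dvd b"
proof
  assume "Zlam_dvd (of_int n) (of_int a + of_int b * lam)"
  then obtain c d :: int
    where "of_int a + of_int b * lam = of_int n * (of_int c + of_int d * lam)"
    unfolding Zlam_dvd_def by (metis Zlam_cases)
  then have "of_int a + of_int b * lam = of_int (n * c) + of_int (n * d) * lam"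
    by (simp add: algebra_simps)
  from lam_coords_unique[OF this] show "n dvd a \<and> n dvd b" by simp
next
  assume "n dvd a \<and> n dvd b"
  then obtain c d where cd: "a = n * c" "b = n * d" by (auto elim!: dvdE)
  show "Zlam_dvd (of_int n) (of_int a + of_int b * lam)"
    unfolding Zlam_dvd_def
    by (rule bexI[of _ "of_int c + of_int d * lam"]) (auto simp: cd algebra_simps intro!: Zlam_intros)
qed

text \<open>The residue ring modulo 2 is the field with four elements; this is read off from the
  parities of the coordinates.\<close>

lemma two_prime:
  assumes "x \<in> Zlam" "y \<in> Zlam" "Zlam_dvd 2 (x * y)"
  shows "Zlam_dvd 2 x \<or> Zlam_dvd 2 y"
proof -
  obtain a b where x: "x = of_int a + of_int b * lam" using assms(1) by (rule Zlam_cases)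
  obtain c d where y: "y = of_int c + of_int d * lam" using assms(2) by (rule Zlam_cases)
  have "x * y = of_int (a * c + b * d) + of_int (a * d + b * c + b * d) * lam"
    unfolding x y by (simp add: lam_simps)
  then have "even (a * c + b * d) \<and> even (a * d + b * c + b * d)"
    using assms(3) Zlam_dvd_of_int_coords[of 2 "a * c + b * d" "a * d + b * c + b * d"]
    by (simp only: of_int_numeral)
  then have "even a \<and> even b \<or> even c \<and> even d"
    by (auto simp: even_add even_mult_iff)
  then show ?thesis
    unfolding x y using Zlam_dvd_of_int_coords[of 2] by simp
qed

section \<open>Matrices in the Hecke group\<close>

text \<open>Four entries instead of a matrix turn group identities into polynomial identities within
  reach of \<open>algebra\<close>. Determinant 1 is implied, see \<open>hk_D\<close>.\<close>

definition hk :: "real \<Rightarrow> real \<Rightarrow> real \<Rightarrow> real \<Rightarrow> bool" where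
  "hk a b c d \<longleftrightarrow> psl_class (mat2 a b c d) \<in> hecke_group"

lemma mat2_mult:
  "mat2 a b c d ** mat2 a' b' c' d'
    = mat2 (a * a' + b * c') (a * b' + b * d') (c * a' + d * c') (c * b' + d * d')"
  by (simp add: vec_eq_iff forall_2 matrix_matrix_mult_def sum_2)

lemma mat2_minus: "- mat2 a b c d = mat2 (- a) (- b) (- c) (- d)"
  by (simp add: vec_eq_iff forall_2)

lemma mat2_eq_iff: "mat2 a b c d = mat2 a' b' c' d' \<longleftrightarrow> a = a' \<and> b = b' \<and> c = c' \<and> d = d'"
  by (auto simp: vec_eq_iff forall_2)

lemma mat2_adj2: "adj2 (mat2 a b c d) = mat2 d (- b) (- c) a"
  by (simp add: adj2_def)

lemma mat2_one: "mat 1 = mat2 1 0 0 1"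
  by (simp add: vec_eq_iff forall_2 mat_def)

lemma det_mat2: "det (mat2 a b c d) = a * d - b * c"
  by (simp add: det_2)

lemma mat2_surj: "A = mat2 (A $ 1 $ 1) (A $ 1 $ 2) (A $ 2 $ 1) (A $ 2 $ 2)"
  by (simp add: vec_eq_iff forall_2)

lemma psl_class_eq_iff: "psl_class A = psl_class B \<longleftrightarrow> A = B \<or> A = - B"
  by (auto simp: psl_class_eq doubleton_eq_iff)

lemma psl_class_mat2_mult:
  assumes "a * d - b * c = 1" "a' * d' - b' * c' = 1"
  shows "psl_class (mat2 a b c d) \<otimes>\<^bsub>PSL2R\<^esub> psl_class (mat2 a' b' c' d')
    = psl_class (mat2 (a * a' + b * c') (a * b' + b * d') (c * a' + d * c') (c * b' + d * d'))"
  using assms by (simp add: psl_class_mult det_mat2 mat2_mult)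

lemma psl_class_mat2_inv:
  assumes "a * d - b * c = 1"
  shows "inv\<^bsub>PSL2R\<^esub> psl_class (mat2 a b c d) = psl_class (mat2 d (- b) (- c) a)"
  using assms by (simp add: psl_class_inv det_mat2 mat2_adj2)

text \<open>A class leaves the sign of its matrix open, hence the case \<open>neg\<close>. The
  determinant is supplied in \<open>inv\<close> for predicates that do not record it.\<close>

lemma hk_induct [consumes 1, case_names one S T mult inv neg]:
  assumes hk: "hk a b c d"
    and one: "P 1 0 0 1"
    and S: "P 0 (-1) 1 0"
    and T: "P 1 lam 0 1"
    and mult: "\<And>a b c d a' b' c' d'. P a b c d \<Longrightarrow> P a' b' c' d'
      \<Longrightarrow> P (a * a' + b * c') (a * b' + b * d') (c * a' + d * c') (c * b' + d * d')"
    and inv: "\<And>a b c d. a * d - b * c = 1 \<Longrightarrow> P a b c d \<Longrightarrow> P d (- b) (- c) a"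
    and neg: "\<And>a b c d. P a b c d \<Longrightarrow> P (- a) (- b) (- c) (- d)"
  shows "P a b c d"
proof -
  have "\<exists>a b c d. a * d - b * c = 1 \<and> P a b c d \<and> X = psl_class (mat2 a b c d)"
    if "X \<in> hecke_group" for X
    using that unfolding hecke_group_def
  proof (induction rule: generate.induct)
    case one
    show ?case
      by (rule exI[of _ 1], rule exI[of _ 0], rule exI[of _ 0], rule exI[of _ 1])
         (simp add: \<open>P 1 0 0 1\<close> psl_class_one mat2_one)
  next
    case (incl X)
    then consider "X = psl_class (mat2 0 (-1) 1 0)" | "X = psl_class (mat2 1 lam 0 1)" by blast
    then show ?case using S T
      by cases (metis diff_0 minus_mult_commute mult_1 mult_zero_left minus_minus,
          metis diff_zero mult_1 mult_zero_right)
  next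
    case (inv X)
    then consider "X = psl_class (mat2 0 (-1) 1 0)" | "X = psl_class (mat2 1 lam 0 1)" by blast
    then show ?case
    proof cases
      case 1
      have "P 0 (- (-1)) (-1) 0" by (rule assms(6)) (simp_all add: S)
      then show ?thesis unfolding 1
        by (intro exI[of _ 0] exI[of _ 1] exI[of _ "-1"]) (simp add: psl_class_mat2_inv)
    next
      case 2
      have "P 1 (- lam) (- 0) 1" by (rule assms(6)) (simp_all add: T)
      then show ?thesis unfolding 2
        by (intro exI[of _ 1] exI[of _ "- lam"] exI[of _ 0]) (simp add: psl_class_mat2_inv)
    qed
  next
    case (eng X Y)
    then obtain a b c d a' b' c' d' where
      *: "a * d - b * c = 1" "P a b c d" "X = psl_class (mat2 a b c d)"
        "a' * d' - b' * c' = 1" "P a' b' c' d'" "Y = psl_class (mat2 a' b' c' d')"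
      by blast
    have "(a * a' + b * c') * (c * b' + d * d') - (a * b' + b * d') * (c * a' + d * c')
        = (a * d - b * c) * (a' * d' - b' * c')" by algebra
    then show ?case
      using mult[OF *(2,5)] psl_class_mat2_mult[OF *(1,4)] * by (metis mult_1)
  qed
  from this[OF hk[unfolded hk_def]] obtain a' b' c' d' where
    "P a' b' c' d'" "psl_class (mat2 a b c d) = psl_class (mat2 a' b' c' d')" by blast
  then show ?thesis
    using neg by (auto simp: psl_class_eq_iff mat2_minus mat2_eq_iff)
qed

lemma hk_D:
  assumes "hk a b c d"
  shows "a \<in> Zlam" "b \<in> Zlam" "c \<in> Zlam" "d \<in> Zlam" "a * d - b * c = 1"
proof -
  have "a \<in> Zlam \<and> b \<in> Zlam \<and> c \<in> Zlam \<and> d \<in> Zlam \<and> a * d - b * c = 1"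
    using assms
  proof (induction rule: hk_induct)
    case (mult a b c d a' b' c' d')
    have "(a * a' + b * c') * (c * b' + d * d') - (a * b' + b * d') * (c * a' + d * c')
        = (a * d - b * c) * (a' * d' - b' * c')" by algebra
    then show ?case using mult by (auto intro!: Zlam_intros)
  qed (auto intro!: Zlam_intros simp: algebra_simps)
  then show "a \<in> Zlam" "b \<in> Zlam" "c \<in> Zlam" "d \<in> Zlam" "a * d - b * c = 1" by auto
qed

lemma hk_one: "hk 1 0 0 1"
  unfolding hk_def mat2_one[symmetric] psl_class_one[symmetric]
  by (rule subgroup.one_closed[OF subgroup_hecke_group])

lemma hk_S: "hk 0 (-1) 1 0"
  unfolding hk_def hecke_group_def by (rule generate.incl) simp

lemma hk_mult:
  assumes "hk a b c d" "hk a' b' c' d'"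
  shows "hk (a * a' + b * c') (a * b' + b * d') (c * a' + d * c') (c * b' + d * d')"
  using subgroup.m_closed[OF subgroup_hecke_group, of "psl_class (mat2 a b c d)" "psl_class (mat2 a' b' c' d')"]
    assms hk_D(5)[OF assms(1)] hk_D(5)[OF assms(2)] by (simp add: hk_def psl_class_mat2_mult)

lemma hk_inv: "hk a b c d \<Longrightarrow> hk d (- b) (- c) a"
  using subgroup.m_inv_closed[OF subgroup_hecke_group, of "psl_class (mat2 a b c d)"]
    hk_D(5)[of a b c d] by (simp add: hk_def psl_class_mat2_inv)

lemma hk_neg: "hk a b c d \<Longrightarrow> hk (- a) (- b) (- c) (- d)"
  unfolding hk_def mat2_minus[symmetric] by (simp add: psl_class_eq insert_commute)

lemma hk_T1: "hk 1 lam 0 1"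
  unfolding hk_def hecke_group_def by (rule generate.incl) simp

lemma hk_T: "hk 1 (of_int n * lam) 0 1"
proof -
  have T: "hk 1 (of_nat k * lam) 0 1" for k
  proof (induction k)
    case (Suc k)
    from hk_mult[OF this hk_T1] show ?case by (simp add: algebra_simps)
  qed (simp add: hk_one)
  show ?thesis
  proof (cases "n \<ge> 0")
    case True
    then show ?thesis using T[of "nat n"] by simp
  next
    case False
    then show ?thesis using hk_inv[OF T[of "nat (- n)"]] by simp
  qed
qed

text \<open>The element rho = T S. Its successive products with T, in the next three lemmas, become
  rules of \<open>quadrant_orbit\<close>.\<close>

lemma hk_rho: "hk lam (-1) 1 0"
  using hk_mult[OF hk_T1 hk_S] by simp

lemma hk_rho_T: "hk lam lam 1 lam"
  using hk_mult[OF hk_rho hk_T1] by (simp add: lam_squared)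

lemma hk_rho2_T: "hk lam 1 lam lam"
  using hk_mult[OF hk_rho hk_rho_T] by (simp add: lam_squared)

lemma hk_rho3_T: "hk 1 0 lam 1"
  using hk_mult[OF hk_rho hk_rho2_T] by (simp add: lam_squared)

section \<open>The orbit of \<open>(1, 0)\<close>\<close>

definition Lam :: "real \<Rightarrow> real \<Rightarrow> bool" where
  "Lam x y \<longleftrightarrow> (\<exists>b d. hk x b y d)"

lemma Lam_hk: "hk a b c d \<Longrightarrow> Lam x y \<Longrightarrow> Lam (a * x + b * y) (c * x + d * y)"
  unfolding Lam_def by (blast dest: hk_mult)

lemma Lam_neg: "Lam x y \<Longrightarrow> Lam (- x) (- y)"
  unfolding Lam_def by (blast dest: hk_neg)

lemma Lam_S: "Lam x y \<Longrightarrow> Lam (- y) x"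
  using Lam_hk[OF hk_S] by simp

lemma Lam_1_0: "Lam 1 0"
  unfolding Lam_def using hk_one by blast

lemma Lam_0_1: "Lam 0 1"
  using Lam_S[OF Lam_1_0] by simp

lemma Lam_Zlam: "Lam x y \<Longrightarrow> x \<in> Zlam \<and> y \<in> Zlam"
  unfolding Lam_def using hk_D by blast

text \<open>The upper half plane is the union of the cones \<open>\<rho>\<^sup>i C\<close>, \<open>i < 5\<close>, where \<open>\<rho> = T S\<close> satisfies
  \<open>\<rho>\<^sup>5 = - 1\<close> and \<open>C\<close> is spanned by \<open>(1, 0)\<close> and \<open>(\<lambda>, 1)\<close>. The first four of them are the images
  of the first quadrant under the nonnegative matrices \<open>\<rho>\<^sup>i T\<close> and make up that quadrant, so the
  vectors of the orbit in the first quadrant are generated as follows.\<close>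

inductive quadrant_orbit :: "real \<Rightarrow> real \<Rightarrow> bool" where
  e1: "quadrant_orbit 1 0"
| e2: "quadrant_orbit 0 1"
| s0: "quadrant_orbit x y \<Longrightarrow> quadrant_orbit (x + lam * y) y"
| s1: "quadrant_orbit x y \<Longrightarrow> quadrant_orbit (lam * x + lam * y) (x + lam * y)"
| s2: "quadrant_orbit x y \<Longrightarrow> quadrant_orbit (lam * x + y) (lam * x + lam * y)"
| s3: "quadrant_orbit x y \<Longrightarrow> quadrant_orbit x (lam * x + y)"

text \<open>Reflection in the diagonal exchanges \<open>s0\<close> with \<open>s3\<close> and
  \<open>s1\<close> with \<open>s2\<close>.\<close>

lemma quadrant_orbit_swap: "quadrant_orbit x y \<Longrightarrow> quadrant_orbit y x"
proof (induction rule: quadrant_orbit.induct)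
  case (s0 x y)
  from quadrant_orbit.s3[OF s0.IH] show ?case by (simp add: add.commute)
next
  case (s1 x y)
  from quadrant_orbit.s2[OF s1.IH] show ?case by (simp add: add.commute)
next
  case (s2 x y)
  from quadrant_orbit.s1[OF s2.IH] show ?case by (simp add: add.commute)
next
  case (s3 x y)
  from quadrant_orbit.s0[OF s3.IH] show ?case by (simp add: add.commute)
qed (auto intro: quadrant_orbit.intros)

lemma lam_mult_ge: "x \<ge> 0 \<Longrightarrow> lam * x \<ge> x"
  using mult_right_mono[of 1 lam x] lam_gt_1 by simp

lemma lam_mult_ge_lam: "x \<ge> 1 \<Longrightarrow> lam * x \<ge> lam"
  using mult_left_mono[of 1 x lam] lam_gt_1 by simp

text \<open>The four matrices have entries 0, 1 or \<open>lam > 1\<close>, so off the axes neither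
  coordinate can drop below 1. The bound decides which predecessors a vector of small height can
  have.\<close>

lemma quadrant_orbit_bounds:
  "quadrant_orbit x y \<Longrightarrow> x = 0 \<and> y = 1 \<or> x = 1 \<and> y = 0 \<or> x \<ge> 1 \<and> y \<ge> 1"
proof (induction rule: quadrant_orbit.induct)
  case (s0 x y)
  from s0.IH show ?case
  proof (elim disjE conjE)
    assume "x \<ge> 1" "y \<ge> 1"
    then show ?case using lam_mult_ge[of y] by linarith
  qed (use lam_gt_1 in auto)
next
  case (s1 x y)
  from s1.IH show ?case
  proof (elim disjE conjE)
    assume "x \<ge> 1" "y \<ge> 1"
    then show ?case using lam_mult_ge[of x] lam_mult_ge[of y] by linarith
  qed (use lam_gt_1 in auto)
next
  case (s2 x y)
  from s2.IH show ?case
  proof (elim disjE conjE)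
    assume "x \<ge> 1" "y \<ge> 1"
    then show ?case using lam_mult_ge[of x] lam_mult_ge[of y] by linarith
  qed (use lam_gt_1 in auto)
next
  case (s3 x y)
  from s3.IH show ?case
  proof (elim disjE conjE)
    assume "x \<ge> 1" "y \<ge> 1"
    then show ?case using lam_mult_ge[of x] by linarith
  qed (use lam_gt_1 in auto)
qed auto

text \<open>At height 1 the bounds leave only axis vectors as predecessors, except under
  \<open>s0\<close>, which keeps the height and adds \<open>lam\<close>.\<close>

lemma quadrant_orbit_1: "quadrant_orbit x y \<Longrightarrow> y = 1 \<Longrightarrow> \<exists>n::int. x = of_int n * lam"
proof (induction rule: quadrant_orbit.induct)
  case e2
  show ?case by (rule exI[of _ 0]) simp
next
  case (s0 x y)
  then obtain n where "x = of_int n * lam" by blast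
  then show ?case using s0.prems by (intro exI[of _ "n + 1"]) (simp add: algebra_simps)
next
  case (s1 x y)
  from quadrant_orbit_bounds[OF s1.hyps] have "x = 1 \<and> y = 0"
  proof (elim disjE conjE)
    assume "x \<ge> 1" "y \<ge> 1"
    then show ?thesis using lam_mult_ge[of y] s1.prems by linarith
  qed (use s1.prems lam_gt_1 in auto)
  then show ?case by (intro exI[of _ 1]) simp
next
  case (s2 x y)
  have "lam * x + lam * y > 1"
  proof -
    have "x + y \<ge> 1" using quadrant_orbit_bounds[OF s2.hyps] by auto
    then have "lam * (x + y) \<ge> lam * 1" using lam_pos by (intro mult_left_mono) auto
    then show ?thesis using lam_gt_1 by (simp add: distrib_left)
  qed
  then show ?case using s2.prems by simp
next
  case (s3 x y)
  from quadrant_orbit_bounds[OF s3.hyps] have "x = 0"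
  proof (elim disjE conjE)
    assume "x \<ge> 1" "y \<ge> 1"
    then show ?thesis using lam_mult_ge[of x] s3.prems by linarith
  qed (use s3.prems lam_gt_1 in auto)
  then show ?case by (intro exI[of _ 0]) simp
qed auto

text \<open>As at height 1, only \<open>s0\<close> can be iterated, and it now adds
  \<open>lam * lam = lam + 1\<close>. That the multiples are by integers is essential, since
  \<open>lam + 1\<close> is a unit of the ring.\<close>

lemma quadrant_orbit_lam:
  "quadrant_orbit x y \<Longrightarrow> y = lam
    \<Longrightarrow> \<exists>n::int. x = 1 + of_int n * (lam + 1) \<or> x = - 1 + of_int n * (lam + 1)"
proof (induction rule: quadrant_orbit.induct)
  case (s0 x y)
  then obtain n :: int where "x = 1 + of_int n * (lam + 1) \<or> x = - 1 + of_int n * (lam + 1)" by blast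
  then show ?case using s0.prems lam_squared
    by (intro exI[of _ "n + 1"]) (auto simp: algebra_simps)
next
  case (s1 x y)
  from quadrant_orbit_bounds[OF s1.hyps] have "x = 0 \<and> y = 1"
  proof (elim disjE conjE)
    assume "x \<ge> 1" "y \<ge> 1"
    then show ?thesis using lam_mult_ge_lam[of y] s1.prems by linarith
  qed (use s1.prems lam_gt_1 in auto)
  then show ?case by (intro exI[of _ 1]) simp
next
  case (s2 x y)
  have "lam * (x + y) = lam * 1" using s2.prems by (simp add: distrib_left)
  then have "x + y = 1" using lam_pos by simp
  then have "x = 0 \<and> y = 1 \<or> x = 1 \<and> y = 0"
    using quadrant_orbit_bounds[OF s2.hyps] by auto
  then show ?case
    by (elim disjE) (rule exI[of _ 0], simp, rule exI[of _ 1], simp)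
next
  case (s3 x y)
  from quadrant_orbit_bounds[OF s3.hyps] have "x = 1 \<and> y = 0"
  proof (elim disjE conjE)
    assume "x \<ge> 1" "y \<ge> 1"
    then show ?thesis using lam_mult_ge_lam[of x] s3.prems by linarith
  qed (use s3.prems lam_gt_1 in auto)
  then show ?case by (intro exI[of _ 0]) simp
qed (use lam_gt_1 in auto)

text \<open>The predicate on the first quadrant, rotated by the powers of \<open>S\<close>. Its
  invariance under the whole group makes it a necessary condition for \<open>Lam\<close>.\<close>

definition orbit_cone :: "real \<Rightarrow> real \<Rightarrow> bool" where
  "orbit_cone x y \<longleftrightarrow> quadrant_orbit x y \<or> quadrant_orbit (- x) (- y)
    \<or> quadrant_orbit (- y) x \<or> quadrant_orbit y (- x)"

lemma orbit_cone_S: "orbit_cone (- y) x \<longleftrightarrow> orbit_cone x y"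
  unfolding orbit_cone_def by auto

lemma orbit_cone_neg: "orbit_cone (- x) (- y) \<longleftrightarrow> orbit_cone x y"
  unfolding orbit_cone_def by auto

text \<open>rho carries the cone of rho^i T to that of rho^(i+1) T; from the last rule
  \<open>s3\<close> it reaches rho^4 T = S, that is, the second quadrant.\<close>

lemma quadrant_orbit_rho:
  assumes "quadrant_orbit x y"
  shows "orbit_cone (lam * x - y) x"
  using assms
proof cases
  case e1
  then show ?thesis
    using quadrant_orbit.s0[OF quadrant_orbit.e2] by (simp add: orbit_cone_def)
next
  case e2
  then show ?thesis by (simp add: orbit_cone_def quadrant_orbit.e1)
next
  case (s0 x')
  then show ?thesis
    using quadrant_orbit.s1[OF s0(2)] by (simp add: orbit_cone_def lam_simps)
next
  case (s1 x' y')
  then show ?thesis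
    using quadrant_orbit.s2[OF s1(3)] by (simp add: orbit_cone_def lam_simps)
next
  case (s2 x' y')
  then show ?thesis
    using quadrant_orbit.s3[OF s2(3)] by (simp add: orbit_cone_def lam_simps)
next
  case (s3 y')
  then show ?thesis by (simp add: orbit_cone_def)
qed

lemma orbit_cone_rho:
  assumes "orbit_cone x y"
  shows "orbit_cone (lam * x - y) x"
proof -
  have *: "orbit_cone (lam * x - y) x" if "quadrant_orbit x y \<or> quadrant_orbit (- y) x" for x y
    using that
  proof
    \<comment> \<open>Since rho = T S, the vector rho (x, y) is T applied to S (x, y), which here
      lies in the first quadrant.\<close>
    assume "quadrant_orbit (- y) x"
    from quadrant_orbit.s0[OF this] show ?thesis by (simp add: orbit_cone_def)
  qed (rule quadrant_orbit_rho)
  show ?thesis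
    using assms *[of x y] *[of "- x" "- y"] orbit_cone_neg[of "lam * x - y" x]
    by (auto simp: orbit_cone_def)
qed

lemma orbit_cone_rho_iff: "orbit_cone (lam * x - y) x \<longleftrightarrow> orbit_cone x y"
proof
  assume "orbit_cone (lam * x - y) x"
  \<comment> \<open>rho^5 = -1, so four more applications undo the first one up to sign.\<close>
  from this[THEN orbit_cone_rho, THEN orbit_cone_rho, THEN orbit_cone_rho, THEN orbit_cone_rho]
  have "orbit_cone (- x) (- y)" by (simp add: lam_simps)
  then show "orbit_cone x y" by (simp add: orbit_cone_neg)
qed (rule orbit_cone_rho)

lemma hk_orbit_cone:
  assumes "hk a b c d"
  shows "orbit_cone (a * x + b * y) (c * x + d * y) \<longleftrightarrow> orbit_cone x y"
proof -
  have "\<forall>x y. orbit_cone (a * x + b * y) (c * x + d * y) \<longleftrightarrow> orbit_cone x y"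
    using assms
  proof (induction rule: hk_induct)
    case S
    then show ?case by (simp add: orbit_cone_S)
  next
    case T
    show ?case
      using orbit_cone_rho_iff orbit_cone_S by (simp add: add.commute) (metis add.commute diff_minus_eq_add minus_minus)
  next
    case (mult a b c d a' b' c' d')
    show ?case
    proof (intro allI)
      fix x y
      show "orbit_cone ((a * a' + b * c') * x + (a * b' + b * d') * y)
          ((c * a' + d * c') * x + (c * b' + d * d') * y) = orbit_cone x y"
        using mult(1)[rule_format, of "a' * x + b' * y" "c' * x + d' * y"] mult(2)
        by (simp add: algebra_simps)
    qed
  next
    case (inv a b c d)
    show ?case
    proof (intro allI)
      fix x y
      have "a * (d * x + - b * y) + b * (- c * x + a * y) = (a * d - b * c) * x"
        "c * (d * x + - b * y) + d * (- c * x + a * y) = (a * d - b * c) * y" by algebra+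
      then show "orbit_cone (d * x + - b * y) (- c * x + a * y) = orbit_cone x y"
        using inv(2)[rule_format, of "d * x + - b * y" "- c * x + a * y"] inv(1)
        by simp
    qed
  next
    case (neg a b c d)
    then show ?case
      using orbit_cone_neg by (metis minus_add_distrib mult_minus_left)
  qed simp
  then show ?thesis by blast
qed

lemma Lam_orbit_cone: "Lam x y \<Longrightarrow> orbit_cone x y"
  unfolding Lam_def using hk_orbit_cone[of x _ y _ 1 0] by (auto simp: orbit_cone_def quadrant_orbit.e1)

text \<open>Only two of the four rotations are compatible with second coordinate 1. This identifies
  the translations in the group, because \<open>hk 1 z 0 1\<close> sends (0, 1) to (z, 1).\<close>

lemma Lam_height_1:
  assumes "Lam x 1"
  obtains n :: int where "x = of_int n * lam"
proof -
  have "quadrant_orbit x 1 \<or> quadrant_orbit 1 (- x)"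
    using Lam_orbit_cone[OF assms] quadrant_orbit_bounds[of "- x" "-1"]
      quadrant_orbit_bounds[of "- 1" x] by (auto simp: orbit_cone_def)
  then have "(\<exists>n::int. x = of_int n * lam) \<or> (\<exists>n::int. - x = of_int n * lam)"
    using quadrant_orbit_1 quadrant_orbit_swap by blast
  then show thesis
    using that by (metis minus_minus mult_minus_left of_int_minus)
qed

text \<open>After a swap the vector has height \<open>lam\<close>, and comparing coordinates forces
  the multiple of \<open>lam + 1\<close> to vanish. This is what excludes translations by
  \<open>lam / n\<close>.\<close>

lemma Lam_lam_int:
  fixes n :: int
  assumes "Lam lam (of_int n)" "n > 0"
  shows "n = 1"
proof -
  have "quadrant_orbit lam (of_int n)"
    using Lam_orbit_cone[OF assms(1)] quadrant_orbit_bounds[of "- lam" "- of_int n"] assms(2) lam_gt_1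
      quadrant_orbit_bounds[of "- of_int n" lam] quadrant_orbit_bounds[of "of_int n" "- lam"]
    by (auto simp: orbit_cone_def)
  then obtain m :: int where "of_int n = 1 + of_int m * (lam + 1) \<or> of_int n = - 1 + of_int m * (lam + 1)"
    using quadrant_orbit_lam quadrant_orbit_swap by blast
  then have "of_int (n - 1 - m) + of_int (- m) * lam = 0 \<or> of_int (n + 1 - m) + of_int (- m) * lam = 0"
    by (auto simp: algebra_simps)
  then show ?thesis using lam_indep assms(2) by fastforce
qed

section \<open>The cusps of the Hecke group\<close>

text \<open>\<open>p\<close> and \<open>q\<close> stand for the conjugates of \<open>X\<close> and
  \<open>Y\<close>. The triangle inequality loses \<open>(lam - 1) * Y * |q|\<close> against a gain
  of \<open>lam * Y * |q|\<close>; the difference \<open>Y * |q|\<close> is at least 1.\<close>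

lemma cusp_descent_s0:
  fixes X Y p q :: real
  assumes "X > 0" "Y > 0" "Y * \<bar>q\<bar> \<ge> 1"
  shows "(X + lam * Y) * \<bar>q\<bar> + Y * \<bar>p + (1 - lam) * q\<bar> \<ge> X * \<bar>q\<bar> + Y * \<bar>p\<bar> + 1/2"
proof -
  have "\<bar>p\<bar> \<le> \<bar>p + (1 - lam) * q\<bar> + \<bar>(1 - lam) * q\<bar>" by linarith
  also have "\<bar>(1 - lam) * q\<bar> = (lam - 1) * \<bar>q\<bar>" using lam_gt_1 by (simp add: abs_mult)
  finally have "Y * \<bar>p\<bar> \<le> Y * (\<bar>p + (1 - lam) * q\<bar> + (lam - 1) * \<bar>q\<bar>)"
    using assms(2) by (intro mult_left_mono) auto
  then show ?thesis using assms(3) by (simp add: algebra_simps)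
qed

text \<open>The counterpart for \<open>s1\<close>. Up to units the new conjugates are
  \<open>D\<close> and \<open>p + q\<close>; combinations of these two recover \<open>p\<close> and
  \<open>q\<close>, which bounds the coefficients of \<open>Y\<close> and \<open>X\<close> from
  below.\<close>

lemma cusp_descent_s1:
  fixes X Y p q :: real
  assumes "X > 0" "Y > 0" "X * \<bar>p\<bar> \<ge> 1" "Y * \<bar>q\<bar> \<ge> 1"
  shows "(lam * X + lam * Y) * \<bar>p + (1 - lam) * q\<bar> + (X + lam * Y) * \<bar>(1 - lam) * p + (1 - lam) * q\<bar>
    \<ge> X * \<bar>q\<bar> + Y * \<bar>p\<bar> + 1/2"
proof -
  \<comment> \<open>\<open>D\<close> is \<open>lam\<close> times the conjugate of the new second
    coordinate \<open>X + lam * Y\<close>.\<close>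
  define D where "D = lam * p - q"
  have lam2: "lam < 2"
    using lam_squared lam_gt_1 mult_left_mono[of 2 lam lam] by (cases "lam < 2") auto
  have "lam * \<bar>p + (1 - lam) * q\<bar> = \<bar>lam * (p + (1 - lam) * q)\<bar>"
    using lam_pos by (simp add: abs_mult)
  also have "lam * (p + (1 - lam) * q) = D" unfolding D_def by (simp add: lam_simps)
  finally have 1: "lam * \<bar>p + (1 - lam) * q\<bar> = \<bar>D\<bar>" .
  have "\<bar>(1 - lam) * p + (1 - lam) * q\<bar> = \<bar>(1 - lam) * (p + q)\<bar>" by (simp add: distrib_left)
  also have "\<dots> = (lam - 1) * \<bar>p + q\<bar>" using lam_gt_1 by (simp add: abs_mult)
  finally have 2: "\<bar>(1 - lam) * p + (1 - lam) * q\<bar> = (lam - 1) * \<bar>p + q\<bar>" .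
  have "(lam * X + lam * Y) * \<bar>p + (1 - lam) * q\<bar> = (X + Y) * (lam * \<bar>p + (1 - lam) * q\<bar>)"
    by (simp add: algebra_simps)
  moreover have "(X + lam * Y) * ((lam - 1) * \<bar>p + q\<bar>) = X * ((lam - 1) * \<bar>p + q\<bar>) + Y * \<bar>p + q\<bar>"
    by (simp add: lam_simps)
  ultimately have V: "(lam * X + lam * Y) * \<bar>p + (1 - lam) * q\<bar>
      + (X + lam * Y) * \<bar>(1 - lam) * p + (1 - lam) * q\<bar>
      = X * (\<bar>D\<bar> + (lam - 1) * \<bar>p + q\<bar>) + Y * (\<bar>D\<bar> + \<bar>p + q\<bar>)"
    unfolding 1 2 by (simp add: algebra_simps)
  have "(lam + 1) * \<bar>p\<bar> = \<bar>D + (p + q)\<bar>"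
  proof -
    have "D + (p + q) = (lam + 1) * p" unfolding D_def by (simp add: algebra_simps)
    then show ?thesis using lam_pos by (simp add: abs_mult)
  qed
  also have "\<dots> \<le> \<bar>D\<bar> + \<bar>p + q\<bar>" by (rule abs_triangle_ineq)
  finally have Y: "Y * ((lam + 1) * \<bar>p\<bar>) \<le> Y * (\<bar>D\<bar> + \<bar>p + q\<bar>)"
    using assms(2) by (intro mult_left_mono) auto
  have "(lam - 1) * (p + q) = (2 - lam) * D + q" unfolding D_def by (simp add: lam_simps)
  then have "(lam - 1) * \<bar>p + q\<bar> = \<bar>(2 - lam) * D + q\<bar>" using lam_gt_1
    by (metis abs_mult abs_of_pos diff_gt_0_iff_gt)
  moreover have "\<bar>(2 - lam) * D\<bar> = (2 - lam) * \<bar>D\<bar>" using lam2 by (simp add: abs_mult)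
  ultimately have "(lam - 1) * \<bar>p + q\<bar> \<ge> \<bar>q\<bar> - (2 - lam) * \<bar>D\<bar>" by linarith
  then have "\<bar>D\<bar> + (lam - 1) * \<bar>p + q\<bar> \<ge> \<bar>q\<bar> + (lam - 1) * \<bar>D\<bar>" by (simp add: algebra_simps)
  then have X: "X * (\<bar>q\<bar> + (lam - 1) * \<bar>D\<bar>) \<le> X * (\<bar>D\<bar> + (lam - 1) * \<bar>p + q\<bar>)"
    using assms(1) by (intro mult_left_mono) auto
  \<comment> \<open>If \<open>|D|\<close> is large, the first term suffices because
    \<open>(lam - 1) * lam = 1\<close>. Otherwise \<open>|q|\<close> is at most 3/2 of
    \<open>lam * |p|\<close>, so \<open>Y * |q| \<ge> 1\<close> makes the second term at least
    2/3.\<close>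
  have "(lam - 1) * (X * \<bar>D\<bar>) + lam * (Y * \<bar>p\<bar>) \<ge> 1/2"
  proof (cases "\<bar>D\<bar> \<ge> lam / 2 * \<bar>p\<bar>")
    case True
    have "1/2 \<le> (lam - 1) * (lam / 2) * (X * \<bar>p\<bar>)"
      using assms(3) by (simp add: lam_simps)
    also have "\<dots> = (lam - 1) * (X * (lam / 2 * \<bar>p\<bar>))" by simp
    also have "\<dots> \<le> (lam - 1) * (X * \<bar>D\<bar>)"
      using True assms(1) lam_gt_1 by (intro mult_left_mono) auto
    finally show ?thesis using assms(1,2) lam_pos by (simp add: add_increasing2)
  next
    case False
    have "\<bar>q\<bar> \<le> lam * \<bar>p\<bar> + \<bar>D\<bar>"
      unfolding D_def using lam_pos abs_mult[of lam p] by linarith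
    then have "\<bar>q\<bar> \<le> 3/2 * (lam * \<bar>p\<bar>)" using False by simp
    then have "Y * \<bar>q\<bar> \<le> Y * (3/2 * (lam * \<bar>p\<bar>))" using assms(2) by (intro mult_left_mono) auto
    then have "1 \<le> 3/2 * (lam * (Y * \<bar>p\<bar>))" using assms(4) by (simp add: algebra_simps)
    moreover have "(lam - 1) * (X * \<bar>D\<bar>) \<ge> 0" using assms(1) lam_gt_1 by simp
    ultimately show ?thesis by linarith
  qed
  then show ?thesis unfolding V using X Y by (simp add: algebra_simps)
qed

lemma Lam_direction_hk:
  assumes "hk a b c d" "\<exists>k u w. Lam u w \<and> X = k * u \<and> Y = k * w"
  shows "\<exists>k u w. Lam u w \<and> a * X + b * Y = k * u \<and> c * X + d * Y = k * w"
proof -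
  obtain k u w where "Lam u w" "X = k * u" "Y = k * w" using assms(2) by blast
  then show ?thesis
    using Lam_hk[OF assms(1) \<open>Lam u w\<close>]
    by (intro exI[of _ k] exI[of _ "a * u + b * w"] exI[of _ "c * u + d * w"] conjI)
      (simp_all add: algebra_simps)
qed

text \<open>Doubling turns a gap of 1/2 into a gap of 1, which survives the floor; a real measure
  can thus drive an induction on naturals.\<close>

lemma floor_less_of_half:
  fixes r s :: real
  assumes "r + 1/2 \<le> s" "0 \<le> r"
  shows "nat \<lfloor>2 * r\<rfloor> < nat \<lfloor>2 * s\<rfloor>"
proof -
  have "\<lfloor>2 * r + 1\<rfloor> \<le> \<lfloor>2 * s\<rfloor>" using assms(1) by (intro floor_mono) simp
  moreover have "\<lfloor>2 * r\<rfloor> \<ge> 0" using assms(2) by simp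
  ultimately show ?thesis by linarith
qed

text \<open>Leutbecher's theorem that the cusps of \<open>G\<^sub>5\<close> are \<open>\<rat>(\<lambda>) \<union> {\<infinity>}\<close>. Stripping off one of the matrices
  \<open>\<rho>\<^sup>i T\<close> keeps a vector in the first quadrant and decreases \<open>x \<bar>y'\<bar> + y \<bar>x'\<bar>\<close>
  (where \<open>'\<close> is the conjugation) by at least \<open>1/2\<close>.\<close>

lemma cusps_quadrant:
  assumes "x \<in> Zlam" "y \<in> Zlam" "x \<ge> 0" "y \<ge> 0"
  shows "\<exists>k u w. Lam u w \<and> x = k * u \<and> y = k * w"
  using assms
proof (induction "nat \<lfloor>2 * (x * \<bar>cj y\<bar> + y * \<bar>cj x\<bar>)\<rfloor>" arbitrary: x y rule: less_induct)
  case less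
  have axis: "\<exists>k u w. Lam u w \<and> X = k * u \<and> Y = k * w" if "X = 0 \<or> Y = 0" for X Y
    using that
  proof
    assume "X = 0"
    then show ?thesis using Lam_0_1 by (intro exI[of _ Y] exI[of _ 0] exI[of _ 1]) simp
  next
    assume "Y = 0"
    then show ?thesis using Lam_1_0 by (intro exI[of _ X] exI[of _ 1] exI[of _ 0]) simp
  qed
  have descent: "\<exists>k u w. Lam u w \<and> X = k * u \<and> Y = k * w"
    if "X \<in> Zlam" "Y \<in> Zlam" "X \<ge> 0" "Y \<ge> 0"
      and "X > 0 \<Longrightarrow> Y > 0 \<Longrightarrow> X * \<bar>cj X\<bar> \<ge> 1 \<Longrightarrow> Y * \<bar>cj Y\<bar> \<ge> 1
        \<Longrightarrow> x * \<bar>cj y\<bar> + y * \<bar>cj x\<bar> \<ge> X * \<bar>cj Y\<bar> + Y * \<bar>cj X\<bar> + 1/2" for X Y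
  proof (cases "X = 0 \<or> Y = 0")
    case False
    then have "X > 0" "Y > 0" using that by auto
    with that cj_norm_ge_1[of X] cj_norm_ge_1[of Y]
    have "X * \<bar>cj Y\<bar> + Y * \<bar>cj X\<bar> + 1/2 \<le> x * \<bar>cj y\<bar> + y * \<bar>cj x\<bar>" by simp
    then have "nat \<lfloor>2 * (X * \<bar>cj Y\<bar> + Y * \<bar>cj X\<bar>)\<rfloor> < nat \<lfloor>2 * (x * \<bar>cj y\<bar> + y * \<bar>cj x\<bar>)\<rfloor>"
      using that by (intro floor_less_of_half) auto
    from less.hyps[OF this] that show ?thesis by simp
  qed (rule axis)
  note cj = cj_add cj_diff cj_mult Zlam_intros
  \<comment> \<open>The four cones, separated by the rays through (lam, 1), (1, 1) and (1, lam). In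
    each case the smaller vector is the preimage under the matrix of that cone.\<close>
  consider "x \<ge> lam * y" | "x < lam * y" "x \<ge> y" | "x < y" "y < lam * x" | "y \<ge> lam * x" by linarith
  then show ?case
  proof cases
    case 1
    define X where "X = x - lam * y"
    have x: "x = X + lam * y" by (simp add: X_def)
    have XZ: "X \<in> Zlam" unfolding X_def by (intro Zlam_intros less.prems)
    have "\<exists>k u w. Lam u w \<and> X = k * u \<and> y = k * w"
    proof (rule descent)
      assume *: "X > 0" "y > 0" "y * \<bar>cj y\<bar> \<ge> 1"
      have "cj x = cj X + (1 - lam) * cj y" unfolding x using XZ less.prems by (simp add: cj)
      then show "x * \<bar>cj y\<bar> + y * \<bar>cj x\<bar> \<ge> X * \<bar>cj y\<bar> + y * \<bar>cj X\<bar> + 1/2"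
        using cusp_descent_s0[OF *] x by simp
    qed (use 1 less.prems XZ in \<open>auto simp: X_def\<close>)
    from Lam_direction_hk[OF hk_T1 this] show ?thesis by (simp add: x)
  next
    case 2
    define X Y where "X = lam * x - lam * y" and "Y = lam * y - x"
    have x: "x = lam * X + lam * Y" and y: "y = X + lam * Y"
      by (simp_all add: X_def Y_def lam_simps)
    have XZ: "X \<in> Zlam" "Y \<in> Zlam" unfolding X_def Y_def by (intro Zlam_intros less.prems)+
    have "\<exists>k u w. Lam u w \<and> X = k * u \<and> Y = k * w"
    proof (rule descent)
      assume *: "X > 0" "Y > 0" "X * \<bar>cj X\<bar> \<ge> 1" "Y * \<bar>cj Y\<bar> \<ge> 1"
      have "cj x = (1 - lam) * cj X + (1 - lam) * cj Y" unfolding x using XZ by (simp add: cj)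
      moreover have "cj y = cj X + (1 - lam) * cj Y" unfolding y using XZ by (simp add: cj)
      ultimately show "x * \<bar>cj y\<bar> + y * \<bar>cj x\<bar> \<ge> X * \<bar>cj Y\<bar> + Y * \<bar>cj X\<bar> + 1/2"
        using cusp_descent_s1[OF *] x y by simp
    qed (use 2 less.prems XZ lam_pos in \<open>auto simp: X_def Y_def\<close>)
    from Lam_direction_hk[OF hk_rho_T this] show ?thesis by (simp add: x y)
  next
    case 3
    define X Y where "X = lam * x - y" and "Y = lam * y - lam * x"
    have x: "x = lam * X + Y" and y: "y = lam * X + lam * Y"
      by (simp_all add: X_def Y_def lam_simps)
    have XZ: "X \<in> Zlam" "Y \<in> Zlam" unfolding X_def Y_def by (intro Zlam_intros less.prems)+
    have "\<exists>k u w. Lam u w \<and> X = k * u \<and> Y = k * w"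
    proof (rule descent)
      assume *: "X > 0" "Y > 0" "X * \<bar>cj X\<bar> \<ge> 1" "Y * \<bar>cj Y\<bar> \<ge> 1"
      have cjx: "cj x = cj Y + (1 - lam) * cj X" unfolding x using XZ by (simp add: cj)
      have cjy: "cj y = (1 - lam) * cj Y + (1 - lam) * cj X" unfolding y using XZ by (simp add: cj)
      show "x * \<bar>cj y\<bar> + y * \<bar>cj x\<bar> \<ge> X * \<bar>cj Y\<bar> + Y * \<bar>cj X\<bar> + 1/2"
        \<comment> \<open>The estimate for \<open>s1\<close> with the two coordinates
          exchanged.\<close>
        unfolding cjx cjy using cusp_descent_s1[OF *(2,1,4,3)] by (simp add: x y algebra_simps)
    qed (use 3 less.prems XZ lam_pos in \<open>auto simp: X_def Y_def\<close>)
    from Lam_direction_hk[OF hk_rho2_T this] show ?thesis by (simp add: x y)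
  next
    case 4
    define Y where "Y = y - lam * x"
    have y: "y = Y + lam * x" by (simp add: Y_def)
    have YZ: "Y \<in> Zlam" unfolding Y_def by (intro Zlam_intros less.prems)
    have "\<exists>k u w. Lam u w \<and> x = k * u \<and> Y = k * w"
    proof (rule descent)
      assume *: "x > 0" "Y > 0" "x * \<bar>cj x\<bar> \<ge> 1"
      have "cj y = cj Y + (1 - lam) * cj x" unfolding y using YZ less.prems by (simp add: cj)
      then show "x * \<bar>cj y\<bar> + y * \<bar>cj x\<bar> \<ge> x * \<bar>cj Y\<bar> + Y * \<bar>cj x\<bar> + 1/2"
        using cusp_descent_s0[OF *(2,1,3), of "cj Y"] y by simp
    qed (use 4 less.prems YZ in \<open>auto simp: Y_def\<close>)
    from Lam_direction_hk[OF hk_rho3_T this] show ?thesis by (simp add: y add.commute)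
  qed
qed

text \<open>A sign change and the rotation \<open>S\<close> reduce every vector to the first
  quadrant.\<close>

theorem cusps:
  assumes "x \<in> Zlam" "y \<in> Zlam"
  obtains k u w where "Lam u w" "x = k * u" "y = k * w"
proof -
  have upper: "\<exists>k u w. Lam u w \<and> x = k * u \<and> y = k * w" if "x \<in> Zlam" "y \<in> Zlam" "y \<ge> 0" for x y
  proof (cases "x \<ge> 0")
    case True
    then show ?thesis using cusps_quadrant that by blast
  next
    case False
    then have "\<exists>k u w. Lam u w \<and> y = k * u \<and> - x = k * w"
      using that by (intro cusps_quadrant Zlam_minus) auto
    from Lam_direction_hk[OF hk_S this] show ?thesis by simp
  qed
  have "\<exists>k u w. Lam u w \<and> x = k * u \<and> y = k * w"
  proof (cases "y \<ge> 0")
    case False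
    then have "\<exists>k u w. Lam u w \<and> - x = k * u \<and> - y = k * w"
      using assms by (intro upper Zlam_minus) auto
    then show ?thesis by (metis minus_minus mult_minus_left)
  qed (use upper assms in blast)
  then show thesis using that by blast
qed

section \<open>The normaliser is contained in the Hecke group\<close>

definition g0 :: "real \<Rightarrow> real \<Rightarrow> real \<Rightarrow> real \<Rightarrow> real \<Rightarrow> bool" where
  "g0 \<tau> a b c d \<longleftrightarrow> hk a b c d \<and> Zlam_dvd \<tau> c"

lemma psl_class_mat2_in_G0: "psl_class (mat2 a b c d) \<in> G0 \<tau> \<longleftrightarrow> g0 \<tau> a b c d"
  by (simp add: psl_class_in_G0 g0_def hk_def)

lemma G0_cases:
  assumes "X \<in> G0 \<tau>"
  obtains a b c d where "X = psl_class (mat2 a b c d)" "g0 \<tau> a b c d"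
proof -
  obtain A where A: "X = psl_class A" using assms by (rule G0_E)
  from assms that[of "A $ 1 $ 1" "A $ 1 $ 2" "A $ 2 $ 1" "A $ 2 $ 2"] show thesis
    unfolding A mat2_surj[of A, symmetric] psl_class_mat2_in_G0[symmetric] by blast
qed

text \<open>\<open>normalizer\<close> is a stabiliser of a set under conjugation. Equality of the
  conjugate with \<open>H\<close> splits into two inclusions, the second one expressed through the
  inverse.\<close>

lemma (in group) mem_normalizer_iff:
  assumes "subgroup H G" "x \<in> carrier G"
  shows "x \<in> normalizer G H \<longleftrightarrow> (\<forall>h\<in>H. x \<otimes> h \<otimes> inv x \<in> H) \<and> (\<forall>h\<in>H. inv x \<otimes> h \<otimes> x \<in> H)"
proof -
  have H: "H \<subseteq> carrier G" using assms(1) by (rule subgroup.subset)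
  have eq: "x <# H #> inv x = (\<lambda>h. x \<otimes> h \<otimes> inv x) ` H"
    by (auto simp: l_coset_def r_coset_def)
  have "x \<in> normalizer G H \<longleftrightarrow> (\<lambda>h. x \<otimes> h \<otimes> inv x) ` H = H"
    using H assms(2) by (simp add: normalizer_def stabilizer_def eq)
  also have "\<dots> \<longleftrightarrow> (\<forall>h\<in>H. x \<otimes> h \<otimes> inv x \<in> H) \<and> (\<forall>h\<in>H. inv x \<otimes> h \<otimes> x \<in> H)"
  proof -
    have cancel: "x \<otimes> (inv x \<otimes> y) = y" "inv x \<otimes> (x \<otimes> y) = y" if "y \<in> carrier G" for y
      using that assms(2) by (simp_all add: m_assoc[symmetric])
    have 1: "x \<otimes> (inv x \<otimes> h \<otimes> x) \<otimes> inv x = h" and 2: "inv x \<otimes> (x \<otimes> h \<otimes> inv x) \<otimes> x = h"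
      if "h \<in> H" for h
      using subsetD[OF H that] assms(2) by (simp_all add: m_assoc cancel)
    show ?thesis
    proof
      assume *: "(\<lambda>h. x \<otimes> h \<otimes> inv x) ` H = H"
      show "(\<forall>h\<in>H. x \<otimes> h \<otimes> inv x \<in> H) \<and> (\<forall>h\<in>H. inv x \<otimes> h \<otimes> x \<in> H)"
      proof (intro conjI ballI)
        fix h assume h: "h \<in> H"
        then show "x \<otimes> h \<otimes> inv x \<in> H" using * by blast
        from h obtain h' where "h' \<in> H" "h = x \<otimes> h' \<otimes> inv x" using * by blast
        then show "inv x \<otimes> h \<otimes> x \<in> H" using 2 by simp
      qed
    next
      assume *: "(\<forall>h\<in>H. x \<otimes> h \<otimes> inv x \<in> H) \<and> (\<forall>h\<in>H. inv x \<otimes> h \<otimes> x \<in> H)"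
      show "(\<lambda>h. x \<otimes> h \<otimes> inv x) ` H = H"
      proof
        show "H \<subseteq> (\<lambda>h. x \<otimes> h \<otimes> inv x) ` H"
        proof
          fix h assume "h \<in> H"
          then show "h \<in> (\<lambda>h. x \<otimes> h \<otimes> inv x) ` H"
            using * 1 by (intro image_eqI[of _ _ "inv x \<otimes> h \<otimes> x"]) auto
        qed
      qed (use * in blast)
    qed
  qed
  finally show ?thesis .
qed

text \<open>The conjugate \<open>M g M^(-1)\<close> written out for M of determinant 1 with rows (p,
  q) and (r, s). This is one inclusion; the other is the same predicate for the inverse of
  M.\<close>

definition normalizes :: "real \<Rightarrow> real \<Rightarrow> real \<Rightarrow> real \<Rightarrow> real \<Rightarrow> bool" where
  "normalizes \<tau> p q r s \<longleftrightarrow> (\<forall>a b c d. g0 \<tau> a b c d \<longrightarrow>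
    g0 \<tau> ((p * a + q * c) * s - (p * b + q * d) * r) ((p * b + q * d) * p - (p * a + q * c) * q)
      ((r * a + s * c) * s - (r * b + s * d) * r) ((r * b + s * d) * p - (r * a + s * c) * q))"

lemma g0_det: "g0 \<tau> a b c d \<Longrightarrow> a * d - b * c = 1"
  unfolding g0_def using hk_D(5) by blast

lemma psl_class_conjugate:
  assumes "p * s - q * r = 1" "a * d - b * c = 1"
  shows "psl_class (mat2 p q r s) \<otimes>\<^bsub>PSL2R\<^esub> psl_class (mat2 a b c d) \<otimes>\<^bsub>PSL2R\<^esub> inv\<^bsub>PSL2R\<^esub> psl_class (mat2 p q r s)
    = psl_class (mat2 ((p * a + q * c) * s - (p * b + q * d) * r) ((p * b + q * d) * p - (p * a + q * c) * q)
      ((r * a + s * c) * s - (r * b + s * d) * r) ((r * b + s * d) * p - (r * a + s * c) * q))"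
proof -
  have "(p * a + q * c) * (r * b + s * d) - (p * b + q * d) * (r * a + s * c)
      = (p * s - q * r) * (a * d - b * c)" by algebra
  with assms show ?thesis
    by (simp add: psl_class_mat2_inv psl_class_mat2_mult mult.commute)
qed

lemma normalizes_iff:
  assumes "p * s - q * r = 1"
  shows "normalizes \<tau> p q r s \<longleftrightarrow> (\<forall>X\<in>G0 \<tau>. psl_class (mat2 p q r s) \<otimes>\<^bsub>PSL2R\<^esub> X
    \<otimes>\<^bsub>PSL2R\<^esub> inv\<^bsub>PSL2R\<^esub> psl_class (mat2 p q r s) \<in> G0 \<tau>)"
proof
  assume *: "normalizes \<tau> p q r s"
  show "\<forall>X\<in>G0 \<tau>. psl_class (mat2 p q r s) \<otimes>\<^bsub>PSL2R\<^esub> X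
    \<otimes>\<^bsub>PSL2R\<^esub> inv\<^bsub>PSL2R\<^esub> psl_class (mat2 p q r s) \<in> G0 \<tau>"
  proof
    fix X assume "X \<in> G0 \<tau>"
    then obtain a b c d where X: "X = psl_class (mat2 a b c d)" and g: "g0 \<tau> a b c d"
      by (rule G0_cases)
    show "psl_class (mat2 p q r s) \<otimes>\<^bsub>PSL2R\<^esub> X
        \<otimes>\<^bsub>PSL2R\<^esub> inv\<^bsub>PSL2R\<^esub> psl_class (mat2 p q r s) \<in> G0 \<tau>"
      unfolding X psl_class_conjugate[OF assms g0_det[OF g]] psl_class_mat2_in_G0
      using * g unfolding normalizes_def by blast
  qed
next
  assume *: "\<forall>X\<in>G0 \<tau>. psl_class (mat2 p q r s) \<otimes>\<^bsub>PSL2R\<^esub> X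
    \<otimes>\<^bsub>PSL2R\<^esub> inv\<^bsub>PSL2R\<^esub> psl_class (mat2 p q r s) \<in> G0 \<tau>"
  show "normalizes \<tau> p q r s"
    unfolding normalizes_def
  proof (intro allI impI)
    fix a b c d assume g: "g0 \<tau> a b c d"
    show "g0 \<tau> ((p * a + q * c) * s - (p * b + q * d) * r) ((p * b + q * d) * p - (p * a + q * c) * q)
      ((r * a + s * c) * s - (r * b + s * d) * r) ((r * b + s * d) * p - (r * a + s * c) * q)"
      unfolding psl_class_mat2_in_G0[symmetric] psl_class_conjugate[OF assms g0_det[OF g], symmetric]
      using * g unfolding psl_class_mat2_in_G0[symmetric] by blast
  qed
qed

lemma mem_normalizer_G0_iff:
  assumes "p * s - q * r = 1"
  shows "psl_class (mat2 p q r s) \<in> normalizer PSL2R (G0 \<tau>)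
    \<longleftrightarrow> normalizes \<tau> p q r s \<and> normalizes \<tau> s (- q) (- r) p"
proof -
  interpret group PSL2R by (rule group_PSL2R)
  have X: "psl_class (mat2 p q r s) \<in> carrier PSL2R"
    using assms by (auto simp: carrier_PSL2R det_mat2)
  have det': "s * p - (- q) * (- r) = 1" using assms by (simp add: mult.commute)
  have inv: "psl_class (mat2 s (- q) (- r) p) = inv\<^bsub>PSL2R\<^esub> psl_class (mat2 p q r s)"
    using assms by (simp add: psl_class_mat2_inv)
  show ?thesis
    unfolding mem_normalizer_iff[OF subgroup_G0 X] normalizes_iff[OF assms] normalizes_iff[OF det'] inv
    using X by simp
qed

text \<open>If \<open>M\<close> normalises \<open>G\<^sub>0(\<tau>)\<close>, it maps a vector \<open>v\<close> of the orbit to \<open>k u\<close>, where \<open>u\<close> is in the orbit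
  by Leutbecher's theorem and \<open>k\<^sup>2\<close> is the ratio of two cusp widths.\<close>

definition rational_on_cusps :: "real \<Rightarrow> real \<Rightarrow> real \<Rightarrow> real \<Rightarrow> bool" where
  "rational_on_cusps p q r s \<longleftrightarrow> (\<forall>x y. Lam x y \<longrightarrow>
    (\<exists>k u w. k\<^sup>2 \<in> \<rat> \<and> Lam u w \<and> p * x + q * y = k * u \<and> r * x + s * y = k * w))"

lemma rational_on_cusps_mult:
  assumes "rational_on_cusps a b c d" "rational_on_cusps a' b' c' d'"
  shows "rational_on_cusps (a * a' + b * c') (a * b' + b * d') (c * a' + d * c') (c * b' + d * d')"
  unfolding rational_on_cusps_def
proof (intro allI impI)
  fix x y assume "Lam x y"
  then obtain k u w where 1: "k\<^sup>2 \<in> \<rat>" "Lam u w" "a' * x + b' * y = k * u" "c' * x + d' * y = k * w"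
    using assms(2) unfolding rational_on_cusps_def by blast
  then obtain l u' w' where 2: "l\<^sup>2 \<in> \<rat>" "Lam u' w'" "a * u + b * w = l * u'" "c * u + d * w = l * w'"
    using assms(1) unfolding rational_on_cusps_def by blast
  have "(a * a' + b * c') * x + (a * b' + b * d') * y = a * (a' * x + b' * y) + b * (c' * x + d' * y)"
    by (simp add: algebra_simps)
  also have "\<dots> = k * (a * u + b * w)" unfolding 1 by (simp add: algebra_simps)
  finally have A: "(a * a' + b * c') * x + (a * b' + b * d') * y = k * l * u'" unfolding 2 by simp
  have "(c * a' + d * c') * x + (c * b' + d * d') * y = c * (a' * x + b' * y) + d * (c' * x + d' * y)"
    by (simp add: algebra_simps)
  also have "\<dots> = k * (c * u + d * w)" unfolding 1 by (simp add: algebra_simps)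
  finally have B: "(c * a' + d * c') * x + (c * b' + d * d') * y = k * l * w'" unfolding 2 by simp
  have "(k * l)\<^sup>2 \<in> \<rat>" using 1(1) 2(1) by (simp add: power_mult_distrib)
  with A B 2(2) show "\<exists>k u w. k\<^sup>2 \<in> \<rat> \<and> Lam u w
      \<and> (a * a' + b * c') * x + (a * b' + b * d') * y = k * u
      \<and> (c * a' + d * c') * x + (c * b' + d * d') * y = k * w" by blast
qed

lemma rational_on_cusps_hk:
  assumes "hk a b c d"
  shows "rational_on_cusps a b c d"
  unfolding rational_on_cusps_def
proof (intro allI impI)
  fix x y assume "Lam x y"
  then have "Lam (a * x + b * y) (c * x + d * y)" by (rule Lam_hk[OF assms])
  then show "\<exists>k u w. k\<^sup>2 \<in> \<rat> \<and> Lam u w \<and> a * x + b * y = k * u \<and> c * x + d * y = k * w"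
    by (intro exI[of _ 1] exI[of _ "a * x + b * y"] exI[of _ "c * x + d * y"]) simp
qed

lemma rational_on_cusps_neg:
  assumes "rational_on_cusps a b c d"
  shows "rational_on_cusps (- a) (- b) (- c) (- d)"
  using rational_on_cusps_mult[OF rational_on_cusps_hk[OF hk_neg[OF hk_one]] assms] by simp

section \<open>Translations and upper triangular matrices\<close>

lemma rational_translation:
  assumes "rational_on_cusps 1 z 0 1"
  obtains k u w where "k\<^sup>2 \<in> \<rat>" "Lam u w" "u = w * z" "w * k = 1"
proof -
  obtain k u w where *: "k\<^sup>2 \<in> \<rat>" "Lam u w" "1 * 0 + z * 1 = k * u" "0 * 0 + 1 * 1 = k * w"
    using assms Lam_0_1 unfolding rational_on_cusps_def by blast
  then have z: "z = k * u" and wk: "w * k = 1" by (simp_all add: mult.commute)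
  have "w * z = (w * k) * u" unfolding z by simp
  then have "u = w * z" unfolding wk by simp
  with * wk show thesis using that by blast
qed

text \<open>\<open>e\<close> divides the determinant 1 of a matrix completing the vector, so it is a
  unit; its square being rational, it is a sign.\<close>

lemma unit_of_Lam_multiple:
  assumes "Lam (e * x) (e * y)" "e \<in> Zlam" "x \<in> Zlam" "y \<in> Zlam" "e\<^sup>2 \<in> \<rat>"
  shows "Lam x y"
proof -
  obtain b d where hk: "hk (e * x) b (e * y) d" using assms(1) unfolding Lam_def by blast
  then have "e * (x * d - b * y) = 1" using hk_D(5)[OF hk] by (simp add: algebra_simps)
  moreover have "x * d - b * y \<in> Zlam" using assms hk_D[OF hk] by (auto intro!: Zlam_intros)
  ultimately have "e = 1 \<or> e = -1" using unit_square_rational assms(2,5) by blast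
  then show ?thesis using assms(1) Lam_neg[of "- x" "- y"] by auto
qed

text \<open>For q = m/n in lowest terms, Bezout yields the translation by \<open>lam / n\<close>. It
  moves (0, 1) in the direction of (lam, n), the scalar to the orbit vector is a unit with rational
  square, and \<open>Lam_lam_int\<close> gives n = 1.\<close>

lemma rational_translations_integral:
  assumes q: "q \<in> \<rat>"
    and trans: "\<And>i j::int. rational_on_cusps 1 ((of_int i * q + of_int j) * lam) 0 1"
  shows "q \<in> \<int>"
proof -
  obtain m n :: int where mn: "n > 0" "coprime m n" "q = of_int m / of_int n"
    using q by (metis Rats_cases')
  obtain i j where ij: "i * m + j * n = 1"
    using mn(2) by (metis bezout_int coprime_iff_gcd_eq_1)
  have "of_int i * q + of_int j = of_int (i * m + j * n) / of_int n"
    using mn by (simp add: field_simps)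
  then have "of_int i * q + of_int j = 1 / of_int n" unfolding ij by simp
  then have "rational_on_cusps 1 (lam / of_int n) 0 1" using trans[of i j] by simp
  then obtain k u w where *: "k\<^sup>2 \<in> \<rat>" "Lam u w" "u = w * (lam / of_int n)" "w * k = 1"
    by (rule rational_translation)
  define e where "e = w / of_int n"
  have u: "u = e * lam" and w: "w = e * of_int n" using * mn(1) by (auto simp: e_def)
  \<comment> \<open>\<open>lam - 1\<close> is the inverse of the unit \<open>lam\<close>.\<close>
  have "e = (lam - 1) * u" unfolding u by (simp add: lam_simps)
  then have "e \<in> Zlam" using Lam_Zlam[OF *(2)] by (auto intro!: Zlam_intros)
  moreover have "e\<^sup>2 \<in> \<rat>"
  proof -
    have "e = inverse (of_int n * k)" using *(4) mn(1) unfolding w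
      by (intro inverse_unique[symmetric]) (simp add: mult_ac)
    then have "e\<^sup>2 = inverse ((of_int n)\<^sup>2 * k\<^sup>2)" by (simp add: power_inverse power_mult_distrib)
    then show ?thesis using *(1) by simp
  qed
  ultimately have "Lam lam (of_int n)"
    using unit_of_Lam_multiple[of e lam "of_int n"] *(2) unfolding u w by (simp add: Zlam_intros)
  then have "n = 1" using mn(1) by (rule Lam_lam_int)
  then show ?thesis using mn by simp
qed

text \<open>Let g in the group have first column v = (x, y), and let n be the norm of \<tau>. Then g
  T^n g^(-1) lies in \<open>G0 \<tau>\<close> and fixes v. Its conjugate by M fixes M v = k u and,
  moved back to infinity, is the translation by \<open>k^2 * n * lam\<close>, which must be an
  integer multiple of \<open>lam\<close>.\<close>

lemma normalizes_rational_on_cusps: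
  assumes "\<tau> \<in> Zlam" "\<tau> \<noteq> 0" and det: "p * s - q * r = 1" and norm: "normalizes \<tau> p q r s"
  shows "rational_on_cusps p q r s"
  unfolding rational_on_cusps_def
proof (intro allI impI)
  fix x y assume "Lam x y"
  then obtain b d where hk: "hk x b y d" unfolding Lam_def by blast
  obtain n :: int where n: "\<tau> * cj \<tau> = of_int n" "n \<noteq> 0" using assms(1,2) by (rule cj_norm)
  define X Y where "X = p * x + q * y" and "Y = r * x + s * y"
  define N where "N = of_int n * lam"
  have N: "N \<noteq> 0" "N \<in> Zlam" using n(2) lam_pos unfolding N_def by (auto intro!: Zlam_intros)
  have "hk (1 - N * (x * y)) (N * x\<^sup>2) (- N * y\<^sup>2) (1 + N * (x * y))"
  proof -
    have eq: "(x * 1 + b * 0) * d + (x * N + b * 1) * - y = 1 - N * (x * y)"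
      "(x * 1 + b * 0) * - b + (x * N + b * 1) * x = N * x\<^sup>2"
      "(y * 1 + d * 0) * d + (y * N + d * 1) * - y = - N * y\<^sup>2"
      "(y * 1 + d * 0) * - b + (y * N + d * 1) * x = 1 + N * (x * y)"
      using hk_D(5)[OF hk] by algebra+
    show ?thesis
      using hk_mult[OF hk_mult[OF hk hk_T[of n, folded N_def]] hk_inv[OF hk]] unfolding eq .
  qed
  moreover have "Zlam_dvd \<tau> (- N * y\<^sup>2)"
  proof -
    have eq: "- N * y\<^sup>2 = \<tau> * (- (cj \<tau> * lam * y\<^sup>2))" unfolding N_def n(1)[symmetric] by simp
    show ?thesis
      unfolding eq using hk_D[OF hk] cj_in_Zlam by (intro Zlam_dvd_self_mult Zlam_intros) auto
  qed
  ultimately have "g0 \<tau> (1 - N * (x * y)) (N * x\<^sup>2) (- N * y\<^sup>2) (1 + N * (x * y))" by (simp add: g0_def)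
  with norm have "g0 \<tau>
      ((p * (1 - N * (x * y)) + q * (- N * y\<^sup>2)) * s - (p * (N * x\<^sup>2) + q * (1 + N * (x * y))) * r)
      ((p * (N * x\<^sup>2) + q * (1 + N * (x * y))) * p - (p * (1 - N * (x * y)) + q * (- N * y\<^sup>2)) * q)
      ((r * (1 - N * (x * y)) + s * (- N * y\<^sup>2)) * s - (r * (N * x\<^sup>2) + s * (1 + N * (x * y))) * r)
      ((r * (N * x\<^sup>2) + s * (1 + N * (x * y))) * p - (r * (1 - N * (x * y)) + s * (- N * y\<^sup>2)) * q)"
    unfolding normalizes_def by blast
  moreover have "(p * (1 - N * (x * y)) + q * (- N * y\<^sup>2)) * s - (p * (N * x\<^sup>2) + q * (1 + N * (x * y))) * r
      = 1 - N * (X * Y)" unfolding X_def Y_def using det by algebra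
  moreover have "(p * (N * x\<^sup>2) + q * (1 + N * (x * y))) * p - (p * (1 - N * (x * y)) + q * (- N * y\<^sup>2)) * q
      = N * X\<^sup>2" unfolding X_def by (simp add: algebra_simps power2_eq_square)
  moreover have "(r * (1 - N * (x * y)) + s * (- N * y\<^sup>2)) * s - (r * (N * x\<^sup>2) + s * (1 + N * (x * y))) * r
      = - N * Y\<^sup>2" unfolding Y_def by (simp add: algebra_simps power2_eq_square)
  moreover have "(r * (N * x\<^sup>2) + s * (1 + N * (x * y))) * p - (r * (1 - N * (x * y)) + s * (- N * y\<^sup>2)) * q
      = 1 + N * (X * Y)" unfolding X_def Y_def using det by algebra
  ultimately have P: "hk (1 - N * (X * Y)) (N * X\<^sup>2) (- N * Y\<^sup>2) (1 + N * (X * Y))"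
    by (simp add: g0_def)
  have Z: "N * X\<^sup>2 \<in> Zlam" "N * (X * Y) \<in> Zlam" "N * Y\<^sup>2 \<in> Zlam"
    using hk_D(2)[OF P] Zlam_diff[OF Zlam_1 hk_D(1)[OF P]] Zlam_minus[OF hk_D(3)[OF P]] by simp_all
  have "\<exists>k u w. Lam u w \<and> X = k * u \<and> Y = k * w"
  proof (cases "X = 0")
    case True
    then show ?thesis using Lam_0_1 by (intro exI[of _ Y] exI[of _ 0] exI[of _ 1]) simp
  next
    case False
    \<comment> \<open>Scaling by \<open>N * X\<close> brings the direction of (X, Y) into the ring,
      although X and Y themselves need not lie there.\<close>
    obtain k u w where kuw: "Lam u w" "N * X\<^sup>2 = k * u" "N * (X * Y) = k * w"
      using Z(1,2) by (rule cusps)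
    have "X = k / (N * X) * u" "Y = k / (N * X) * w"
      using kuw(2,3) False N(1) by (simp_all add: field_simps power2_eq_square)
    then show ?thesis using kuw(1) by blast
  qed
  then obtain k u w where kuw: "Lam u w" "X = k * u" "Y = k * w" by blast
  then obtain b' d' where hk': "hk u b' w d'" unfolding Lam_def by blast
  have det': "u * d' - b' * w = 1" by (rule hk_D(5)[OF hk'])
  have "hk 1 (N * k\<^sup>2) 0 1"
  proof -
    have eq: "(d' * (1 - N * (X * Y)) + - b' * (- N * Y\<^sup>2)) * u + (d' * (N * X\<^sup>2) + - b' * (1 + N * (X * Y))) * w = 1"
      "(d' * (1 - N * (X * Y)) + - b' * (- N * Y\<^sup>2)) * b' + (d' * (N * X\<^sup>2) + - b' * (1 + N * (X * Y))) * d' = N * k\<^sup>2"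
      "(- w * (1 - N * (X * Y)) + u * (- N * Y\<^sup>2)) * u + (- w * (N * X\<^sup>2) + u * (1 + N * (X * Y))) * w = 0"
      "(- w * (1 - N * (X * Y)) + u * (- N * Y\<^sup>2)) * b' + (- w * (N * X\<^sup>2) + u * (1 + N * (X * Y))) * d' = 1"
      unfolding kuw using det'
      by (algebra, algebra, simp add: algebra_simps power2_eq_square, algebra)
    show ?thesis using hk_mult[OF hk_mult[OF hk_inv[OF hk'] P] hk'] unfolding eq .
  qed
  from Lam_hk[OF this Lam_0_1] have "Lam (N * k\<^sup>2) 1" by simp
  then obtain m :: int where "N * k\<^sup>2 = of_int m * lam" by (rule Lam_height_1)
  then have "k\<^sup>2 = of_int m / of_int n"
    unfolding N_def using n(2) lam_pos by (simp add: field_simps)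
  then have "k\<^sup>2 \<in> \<rat>" by simp
  with kuw show "\<exists>k u w. k\<^sup>2 \<in> \<rat> \<and> Lam u w \<and> p * x + q * y = k * u \<and> r * x + s * y = k * w"
    unfolding X_def Y_def by blast
qed

lemma rational_translation_powers:
  assumes "rational_on_cusps 1 z 0 1" "rational_on_cusps 1 (- z) 0 1"
  shows "rational_on_cusps 1 (of_int i * z + of_int j * lam) 0 1"
proof -
  have pow: "rational_on_cusps 1 (of_nat n * z) 0 1" if "rational_on_cusps 1 z 0 1" for z n
  proof (induction n)
    case 0
    show ?case using rational_on_cusps_hk[OF hk_one] by simp
  next
    case (Suc n)
    from rational_on_cusps_mult[OF that this] show ?case by (simp add: algebra_simps)
  qed
  have "rational_on_cusps 1 (of_int i * z) 0 1"
    using pow[OF assms(1), of "nat i"] pow[OF assms(2), of "nat (- i)"] by (cases "i \<ge> 0") auto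
  from rational_on_cusps_mult[OF rational_on_cusps_hk[OF hk_T[of j]] this] show ?thesis by simp
qed

text \<open>Conjugating powers of T gives translations by integer multiples of
  \<open>k^2 * lam\<close>, so \<open>k^2\<close> is an integer; the inverse matrix shows the same
  for \<open>s^2\<close>, whence k is a sign. What remains is a translation, shown to be first by a
  rational and then by an integer multiple of \<open>lam\<close>.\<close>

lemma upper_triangular_rational_on_cusps:
  assumes "rational_on_cusps k y 0 s" "rational_on_cusps s (- y) 0 k" "k * s = 1" "k\<^sup>2 \<in> \<rat>"
  shows "hk k y 0 s"
proof -
  have scale: "k\<^sup>2 \<in> \<int>" if "rational_on_cusps k y 0 s" "rational_on_cusps s (- y) 0 k" "k * s = 1" "k\<^sup>2 \<in> \<rat>"
    for k y s
  proof (rule rational_translations_integral[OF that(4)])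
    fix i j :: int
    have eq: "(k * 1 + y * 0) * s + (k * (of_int i * lam) + y * 1) * 0 = 1"
      "(k * 1 + y * 0) * (- y) + (k * (of_int i * lam) + y * 1) * k = of_int i * k\<^sup>2 * lam"
      "(0 * 1 + s * 0) * s + (0 * (of_int i * lam) + s * 1) * 0 = 0"
      "(0 * 1 + s * 0) * (- y) + (0 * (of_int i * lam) + s * 1) * k = 1"
      using that(3) by algebra+
    have "rational_on_cusps 1 (of_int i * k\<^sup>2 * lam) 0 1"
      using rational_on_cusps_mult[OF rational_on_cusps_mult[OF that(1)
          rational_on_cusps_hk[OF hk_T[of i]]] that(2)] unfolding eq .
    from rational_on_cusps_mult[OF rational_on_cusps_hk[OF hk_T[of j]] this]
    show "rational_on_cusps 1 ((of_int i * k\<^sup>2 + of_int j) * lam) 0 1" by (simp add: algebra_simps)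
  qed
  have "s = inverse k" using assms(3) by (metis inverse_unique)
  then have "s\<^sup>2 \<in> \<rat>" using assms(4) by (simp add: power_inverse)
  then have "s\<^sup>2 \<in> \<int>" using scale[of s "- y" k] assms by (simp add: mult.commute)
  moreover have "k\<^sup>2 \<in> \<int>" using scale assms by blast
  ultimately obtain m n :: int where mn: "k\<^sup>2 = of_int m" "s\<^sup>2 = of_int n" by (auto elim!: Ints_cases)
  have "k\<^sup>2 * s\<^sup>2 = 1" using assms(3) by (metis power_mult_distrib power_one)
  then have "m * n = 1" unfolding mn by (metis of_int_1 of_int_eq_iff of_int_mult)
  moreover have "m \<ge> 0" using mn(1) by (metis of_int_0_le_iff zero_le_power2)
  ultimately have "m = 1" using zmult_eq_1_iff by auto
  then have k: "k = 1 \<and> s = 1 \<or> k = -1 \<and> s = -1"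
    using mn(1) assms(3) by (auto simp: power2_eq_1_iff)
  define z where "z = k * y"
  have z: "rational_on_cusps 1 z 0 1" "rational_on_cusps 1 (- z) 0 1"
    using assms(1,2) rational_on_cusps_neg[OF assms(1)] rational_on_cusps_neg[OF assms(2)] k
    by (auto simp: z_def)
  obtain l u w where *: "l\<^sup>2 \<in> \<rat>" "Lam u w" "u = w * z" "w * l = 1"
    using z(1) by (rule rational_translation)
  have uw: "u \<in> Zlam" "w \<in> Zlam" "w \<noteq> 0" using Lam_Zlam[OF *(2)] *(4) by auto
  \<comment> \<open>The norm of \<open>w\<close> is a denominator for \<open>z\<close>: the multiple
    \<open>n * z\<close> lies in the ring, as \<open>unit_of_Lam_multiple\<close> demands.\<close>
  obtain n :: int where n: "w * cj w = of_int n" "n \<noteq> 0" using uw(2,3) by (rule cj_norm)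
  have "of_int n * z = cj w * u" unfolding n(1)[symmetric] *(3) by simp
  then have nz: "of_int n * z \<in> Zlam" using uw cj_in_Zlam by (auto intro!: Zlam_intros)
  have "rational_on_cusps 1 (of_int n * z) 0 1"
    using rational_translation_powers[OF z, of n 0] by simp
  then obtain l' u' w' where **: "l'\<^sup>2 \<in> \<rat>" "Lam u' w'" "u' = w' * (of_int n * z)" "w' * l' = 1"
    by (rule rational_translation)
  have "w' = inverse l'" using **(4) by (metis inverse_unique mult.commute)
  then have "w'\<^sup>2 \<in> \<rat>" using **(1) by (simp add: power_inverse)
  then have "Lam (of_int n * z) 1"
    using unit_of_Lam_multiple[of w' "of_int n * z" 1] **(2,3) nz Lam_Zlam[OF **(2)] Zlam_1 by simp
  then obtain j :: int where "of_int n * z = of_int j * lam" by (rule Lam_height_1)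
  then have zq: "z = of_int j / of_int n * lam" using n(2) by (simp add: field_simps)
  have "of_int j / of_int n \<in> (\<int> :: real set)"
  proof (rule rational_translations_integral)
    fix i i' :: int
    show "rational_on_cusps 1 ((of_int i * (of_int j / of_int n) + of_int i') * lam) 0 1"
      using rational_translation_powers[OF z, of i i'] unfolding zq by (simp add: algebra_simps)
  qed simp
  then obtain m where "of_int j / of_int n = (of_int m :: real)" by (rule Ints_cases)
  then have "z = of_int m * lam" using zq by simp
  then have "hk 1 z 0 1" using hk_T by simp
  then show ?thesis using k hk_neg[OF \<open>hk 1 z 0 1\<close>] by (auto simp: z_def)
qed

text \<open>M sends (1, 0) to a multiple of an orbit vector; for a group element g with that vector
  as first column, g^(-1) M is upper triangular.\<close>

proposition normalizes_imp_hk: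
  assumes "\<tau> \<in> Zlam" "\<tau> \<noteq> 0" and det: "p * s - q * r = 1"
    and "normalizes \<tau> p q r s" "normalizes \<tau> s (- q) (- r) p"
  shows "hk p q r s"
proof -
  have M: "rational_on_cusps p q r s"
    using assms by (intro normalizes_rational_on_cusps)
  have M': "rational_on_cusps s (- q) (- r) p"
    using assms by (intro normalizes_rational_on_cusps) (auto simp: mult.commute)
  from M Lam_1_0 obtain k u w where *: "k\<^sup>2 \<in> \<rat>" "Lam u w" "p * 1 + q * 0 = k * u" "r * 1 + s * 0 = k * w"
    unfolding rational_on_cusps_def by blast
  then have p: "p = k * u" and r: "r = k * w" by simp_all
  obtain b d where hk: "hk u b w d" using *(2) unfolding Lam_def by blast
  have detg: "u * d - b * w = 1" by (rule hk_D(5)[OF hk])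
  define y s' where "y = d * q - b * s" and "s' = u * s - w * q"
  have "rational_on_cusps (d * p + (- b) * r) (d * q + (- b) * s) ((- w) * p + u * r) ((- w) * q + u * s)"
    by (rule rational_on_cusps_mult[OF rational_on_cusps_hk[OF hk_inv[OF hk]] M])
  moreover have "d * p + (- b) * r = k" "d * q + (- b) * s = y" "(- w) * p + u * r = 0"
    "(- w) * q + u * s = s'" unfolding p r y_def s'_def using detg by (algebra, simp, simp, simp)
  ultimately have U: "rational_on_cusps k y 0 s'" by simp
  have "rational_on_cusps (s * u + (- q) * w) (s * b + (- q) * d) ((- r) * u + p * w) ((- r) * b + p * d)"
    by (rule rational_on_cusps_mult[OF M' rational_on_cusps_hk[OF hk]])
  moreover have "s * u + (- q) * w = s'" "s * b + (- q) * d = - y" "(- r) * u + p * w = 0"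
    "(- r) * b + p * d = k" unfolding p r y_def s'_def using detg by (simp, simp, simp, algebra)
  ultimately have U': "rational_on_cusps s' (- y) 0 k" by simp
  have "k * s' = 1" using det unfolding p r s'_def by (simp add: algebra_simps)
  from upper_triangular_rational_on_cusps[OF U U' this *(1)] have "hk k y 0 s'" .
  from hk_mult[OF hk this]
  have "hk (u * k + b * 0) (u * y + b * s') (w * k + d * 0) (w * y + d * s')" .
  moreover have "u * k + b * 0 = p" "u * y + b * s' = q" "w * k + d * 0 = r" "w * y + d * s' = s"
    unfolding p r y_def s'_def using detg by (simp, algebra, simp, algebra)
  ultimately show ?thesis by simp
qed

section \<open>Divisibility of the lower left entry\<close>

text \<open>Modulo \<open>2\<close> the Hecke group is dihedral of order \<open>10\<close> and preserves the form
  \<open>x\<^sup>2 + \<lambda>xy + y\<^sup>2\<close>.\<close>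

lemma hk_form_mod_2:
  assumes "hk a b c d" "x \<in> Zlam" "y \<in> Zlam"
  shows "Zlam_dvd 2 (((a * x + b * y)\<^sup>2 + lam * (a * x + b * y) * (c * x + d * y) + (c * x + d * y)\<^sup>2)
    - (x\<^sup>2 + lam * x * y + y\<^sup>2))"
proof -
  define Q where "Q x y = x\<^sup>2 + lam * x * y + y\<^sup>2" for x y
  have "a \<in> Zlam \<and> b \<in> Zlam \<and> c \<in> Zlam \<and> d \<in> Zlam \<and>
    (\<forall>x\<in>Zlam. \<forall>y\<in>Zlam. Zlam_dvd 2 (Q (a * x + b * y) (c * x + d * y) - Q x y))"
    using assms(1)
  proof (induction rule: hk_induct)
    case one
    show ?case by (auto simp: Zlam_dvd_def intro!: Zlam_intros bexI[of _ 0])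
  next
    case S
    have "Zlam_dvd 2 (Q (0 * x + -1 * y) (1 * x + 0 * y) - Q x y)" if "x \<in> Zlam" "y \<in> Zlam" for x y
    proof -
      have "Q (0 * x + -1 * y) (1 * x + 0 * y) - Q x y = 2 * (- lam * x * y)"
        unfolding Q_def by (simp add: algebra_simps power2_eq_square)
      then show ?thesis using that by (simp only:) (intro Zlam_dvd_self_mult Zlam_intros)
    qed
    then show ?case by (auto intro!: Zlam_intros)
  next
    case T
    have "Zlam_dvd 2 (Q (1 * x + lam * y) (0 * x + 1 * y) - Q x y)" if "x \<in> Zlam" "y \<in> Zlam" for x y
    proof -
      have "Q (1 * x + lam * y) (0 * x + 1 * y) - Q x y = 2 * (lam * x * y + (lam + 1) * y\<^sup>2)"
        unfolding Q_def by (simp add: lam_simps power2_eq_square)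
      then show ?thesis using that by (simp only:) (intro Zlam_dvd_self_mult Zlam_intros)
    qed
    then show ?case by (auto intro!: Zlam_intros)
  next
    case (mult a b c d a' b' c' d')
    have "Zlam_dvd 2 (Q ((a * a' + b * c') * x + (a * b' + b * d') * y)
        ((c * a' + d * c') * x + (c * b' + d * d') * y) - Q x y)" if xy: "x \<in> Zlam" "y \<in> Zlam" for x y
    proof -
      define X Y where "X = a' * x + b' * y" and "Y = c' * x + d' * y"
      have "X \<in> Zlam" "Y \<in> Zlam" unfolding X_def Y_def using mult xy by (auto intro!: Zlam_intros)
      then have "Zlam_dvd 2 ((Q (a * X + b * Y) (c * X + d * Y) - Q X Y) + (Q X Y - Q x y))"
        using mult xy unfolding X_def Y_def by (intro Zlam_dvd_add) blast+
      moreover have "(a * a' + b * c') * x + (a * b' + b * d') * y = a * X + b * Y"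
        "(c * a' + d * c') * x + (c * b' + d * d') * y = c * X + d * Y"
        unfolding X_def Y_def by (simp_all add: algebra_simps)
      ultimately show ?thesis by simp
    qed
    then show ?case using mult by (auto intro!: Zlam_intros)
  next
    case (inv a b c d)
    have "Zlam_dvd 2 (Q (d * x + - b * y) (- c * x + a * y) - Q x y)" if xy: "x \<in> Zlam" "y \<in> Zlam" for x y
    proof -
      define X Y where "X = d * x + - b * y" and "Y = - c * x + a * y"
      have "X \<in> Zlam" "Y \<in> Zlam" unfolding X_def Y_def using inv xy by (auto intro!: Zlam_intros)
      then have "Zlam_dvd 2 (- (Q (a * X + b * Y) (c * X + d * Y) - Q X Y))"
        using inv unfolding Zlam_dvd_minus by blast
      moreover have "a * X + b * Y = x" "c * X + d * Y = y"
        unfolding X_def Y_def using inv(1) by algebra+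
      ultimately show ?thesis unfolding X_def Y_def by simp
    qed
    then show ?case using inv by (auto intro!: Zlam_intros)
  next
    case (neg a b c d)
    have "Q (- a * x + - b * y) (- c * x + - d * y) = Q (a * x + b * y) (c * x + d * y)" for x y
      unfolding Q_def by (simp add: algebra_simps power2_eq_square)
    then show ?case using neg by (auto intro!: Zlam_intros)
  qed
  then show ?thesis using assms(2,3) unfolding Q_def by blast
qed

text \<open>With \<open>c\<close> even, the invariant form at (1, 0) gives that 2 divides
  \<open>(a - 1) * (a + 1)\<close>; the two factors agree modulo the prime 2. The inverse matrix
  handles \<open>d\<close>.\<close>

lemma hk_even_diagonal:
  assumes "hk a b c d" "Zlam_dvd 2 c"
  shows "Zlam_dvd 2 (a - 1)" "Zlam_dvd 2 (d - 1)"
proof -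
  have *: "Zlam_dvd 2 (a - 1)" if "hk a b c d" "Zlam_dvd 2 c" for a b c d
  proof -
    note Z = hk_D[OF that(1)]
    have "Zlam_dvd 2 ((a\<^sup>2 + lam * a * c + c\<^sup>2) - 1)"
      using hk_form_mod_2[OF that(1) Zlam_1 Zlam_0] by simp
    moreover have "Zlam_dvd 2 ((lam * a + c) * c)"
      using Z by (intro Zlam_dvd_mult_left[OF that(2)] Zlam_intros)
    ultimately have "Zlam_dvd 2 (((a\<^sup>2 + lam * a * c + c\<^sup>2) - 1) - (lam * a + c) * c)"
      by (rule Zlam_dvd_diff)
    then have "Zlam_dvd 2 ((a - 1) * (a + 1))" by (simp add: algebra_simps power2_eq_square)
    then have "Zlam_dvd 2 (a - 1) \<or> Zlam_dvd 2 (a + 1)"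
      using Z by (intro two_prime Zlam_intros)
    moreover have "Zlam_dvd 2 (a - 1)" if "Zlam_dvd 2 (a + 1)"
      using Zlam_dvd_diff[OF that Zlam_dvd_self_mult[OF Zlam_1, of 2]] by (simp add: algebra_simps)
    ultimately show ?thesis by blast
  qed
  show "Zlam_dvd 2 (a - 1)" using *[OF assms] .
  show "Zlam_dvd 2 (d - 1)" using *[OF hk_inv[OF assms(1)]] assms(2) by (simp add: Zlam_dvd_minus)
qed

text \<open>The square of an element congruent to 1 modulo 2 is 1 modulo 4, so an even
  \<open>c\<close> suffices for both h = 2 and h = 4.\<close>

lemma hk_even_square:
  assumes "hk a b c d" "Zlam_dvd 2 c"
  shows "Zlam_dvd 4 (d\<^sup>2 - 1)"
proof -
  obtain e where e: "e \<in> Zlam" "d - 1 = 2 * e"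
    using hk_even_diagonal(2)[OF assms] unfolding Zlam_dvd_def by blast
  then have d: "d = 2 * e + 1" by simp
  have "d\<^sup>2 - 1 = 4 * (e * (e + 1))" unfolding d by (simp add: algebra_simps power2_eq_square)
  then show ?thesis using e by (auto intro!: Zlam_dvd_self_mult Zlam_intros)
qed

lemma Zlam_dvd_1: "x \<in> Zlam \<Longrightarrow> Zlam_dvd 1 x"
  unfolding Zlam_dvd_def by auto

lemma Zlam_dvd_2_4: "Zlam_dvd 4 x \<Longrightarrow> Zlam_dvd 2 x"
  using Zlam_dvd_trans[of 2 4 x] Zlam_dvd_self_mult[of 2 2] Zlam_numeral by simp

lemma hk_square_mod:
  assumes "hk a b c d" "h \<in> {1, 2, 4}" "Zlam_dvd h c"
  shows "Zlam_dvd h (d\<^sup>2 - 1)"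
proof -
  consider "h = 1" | "h = 2" | "h = 4" using assms(2) by blast
  then show ?thesis
  proof cases
    case 1
    then show ?thesis using hk_D[OF assms(1)] by (auto intro!: Zlam_dvd_1 Zlam_intros)
  next
    case 2
    then show ?thesis using hk_even_square[OF assms(1)] assms(3) Zlam_dvd_2_4 by simp
  next
    case 3
    then show ?thesis using hk_even_square[OF assms(1)] assms(3) Zlam_dvd_2_4 by simp
  qed
qed

lemma hk_diagonal_mod:
  assumes "hk a b c d" "h \<in> {1, 2, 4}" "Zlam_dvd h c"
  shows "Zlam_dvd h (a - d)"
proof -
  note Z = hk_D[OF assms(1)]
  have "a - d = d * (b * c) - a * (d\<^sup>2 - 1)" using Z(5) by algebra
  then show ?thesis
    using hk_square_mod[OF assms] assms(3) Z by (auto intro!: Zlam_dvd_diff Zlam_dvd_mult_left)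
qed

text \<open>The lower left entry of the conjugate is \<open>r s (a - d) + s^2 c - r^2 b\<close>.
  Here \<open>h\<close> divides \<open>a - d\<close>, \<open>\<tau>'\<close> divides
  \<open>r\<close>, and \<open>h * \<tau>'\<close> divides both \<open>c\<close> and the square of
  \<open>\<tau>'\<close>.\<close>

lemma hk_normalizes:
  assumes hk: "hk p q r s" and h: "h \<in> {1, 2, 4}" "Zlam_dvd h \<tau>'" and "\<tau>' \<in> Zlam" "Zlam_dvd \<tau>' r"
  shows "normalizes (h * \<tau>') p q r s"
  unfolding normalizes_def
proof (intro allI impI)
  fix a b c d assume g: "g0 (h * \<tau>') a b c d"
  then have A: "hk a b c d" and c: "Zlam_dvd (h * \<tau>') c" by (auto simp: g0_def)
  have hk': "hk ((p * a + q * c) * s - (p * b + q * d) * r) ((p * b + q * d) * p - (p * a + q * c) * q)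
      ((r * a + s * c) * s - (r * b + s * d) * r) ((r * b + s * d) * p - (r * a + s * c) * q)"
    using hk_mult[OF hk_mult[OF hk A] hk_inv[OF hk]] by (simp add: algebra_simps)
  note Z = hk_D[OF hk] hk_D[OF A]
  have "Zlam_dvd h c"
    using Zlam_dvd_trans[OF Zlam_dvd_self_mult c] assms(4) by blast
  then obtain e where e: "e \<in> Zlam" "a - d = h * e"
    using hk_diagonal_mod[OF A h(1)] unfolding Zlam_dvd_def by blast
  obtain t where t: "t \<in> Zlam" "r = \<tau>' * t" using assms(5) unfolding Zlam_dvd_def by blast
  obtain g where g: "g \<in> Zlam" "\<tau>' = h * g" using h(2) unfolding Zlam_dvd_def by blast
  have "(r * a + s * c) * s - (r * b + s * d) * r = r * s * (a - d) + s\<^sup>2 * c - r * r * b"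
    by (simp add: algebra_simps power2_eq_square)
  also have "r * s * (a - d) = h * \<tau>' * (t * s * e)" unfolding e t by simp
  also have "r * r * b = h * \<tau>' * (g * t\<^sup>2 * b)" unfolding t(2) by (subst (2) g(2)) (simp add: power2_eq_square)
  finally have "Zlam_dvd (h * \<tau>') ((r * a + s * c) * s - (r * b + s * d) * r)"
    using c Z e t g by (auto intro!: Zlam_dvd_diff Zlam_dvd_add Zlam_dvd_mult_left Zlam_dvd_self_mult Zlam_intros)
  with hk' show "g0 (h * \<tau>') ((p * a + q * c) * s - (p * b + q * d) * r) ((p * b + q * d) * p - (p * a + q * c) * q)
      ((r * a + s * c) * s - (r * b + s * d) * r) ((r * b + s * d) * p - (r * a + s * c) * q)"
    by (simp add: g0_def)
qed

text \<open>The words \<open>S T\<^sup>k S T\<^sup>l S T\<^sup>x S T S\<close> with \<open>k = 3 - x - y\<close>, \<open>k l \<equiv> y\<close> and \<open>x y \<equiv> 1\<close> modulo \<open>N\<close> have lower row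
  congruent to \<open>(0, - (y - 1) \<lambda> - 1)\<close>. These conditions can be met with \<open>y \<equiv> - 1\<close> modulo the part of \<open>N\<close>
  prime to \<open>5\<close>, where \<open>k \<equiv> 5\<close>, and \<open>y \<equiv> 3\<close> modulo the \<open>5\<close>-part of \<open>N\<close>, where \<open>- 3 k \<equiv> 1\<close>. In both cases
  \<open>((y - 1) \<lambda> + 1)\<^sup>2 - 1\<close> is \<open>4\<close> times a unit.\<close>

lemma hk_unit_parameters:
  fixes N :: int
  assumes "N \<noteq> 0"
  obtains e1 e2 x y l m k1 k2 where "e1 + e2 = 1" "e1 * e2 = N * m" "y = 3 * e2 - e1"
    "x * y = 1 + N * k1" "(3 - x - y) * l = y + N * k2"
proof -
  obtain N1 where N1: "N = 5 ^ multiplicity 5 N * N1" "\<not> 5 dvd N1"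
    using multiplicity_decompose'[of N "5::int"] assms by auto
  define N2 where "N2 = (5::int) ^ multiplicity 5 N"
  have N: "N = N1 * N2" using N1(1) by (simp add: N2_def mult.commute)
  have c5: "coprime 5 N1" using N1(2) by (intro prime_imp_coprime) auto
  then have "coprime N1 N2" unfolding N2_def by (simp add: coprime_commute)
  then obtain \<alpha> \<beta> where ab: "\<alpha> * N1 + \<beta> * N2 = 1" by (metis bezout_int coprime_iff_gcd_eq_1)
  obtain i5 w where i5: "i5 * 5 + w * N1 = 1" using c5 by (metis bezout_int coprime_iff_gcd_eq_1)
  have "coprime 3 (5::int)" by (intro prime_imp_coprime) auto
  then have "coprime 3 N2" unfolding N2_def by simp
  then obtain i3 v where i3: "i3 * 3 + v * N2 = 1" by (metis bezout_int coprime_iff_gcd_eq_1)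
  have cop: "coprime N1 N2" by fact
  \<comment> \<open>Idempotents modulo N: \<open>e1\<close> is 1 modulo \<open>N1\<close> and 0
    modulo \<open>N2\<close>, and \<open>e2\<close> the reverse.\<close>
  define e1 e2 where "e1 = \<beta> * N2" and "e2 = \<alpha> * N1"
  have e: "e1 + e2 = 1" using ab by (simp add: e1_def e2_def)
  \<comment> \<open>Chinese remaindering: modulo \<open>N1\<close> the values of y, x, l are -1, -1,
    -1/5, and modulo \<open>N2\<close> they are 3, 1/3, -9.\<close>
  define y x l where "y = 3 * e2 - e1" and "x = i3 * e2 - e1" and "l = - i5 * e1 - 9 * e2"
  have d1: "N1 dvd e2" and d2: "N2 dvd e1" by (simp_all add: e1_def e2_def)
  have "x * y - 1 = e2 * (- 4 - (i3 + 1) + 4 * (i3 + 1) * e2)"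
    unfolding x_def y_def using e by algebra
  then have "N1 dvd x * y - 1" using d1 by simp
  moreover have "x * y - 1 = - v * N2 + e1 * (- 4 * i3 - 3 * (1 + i3) + 4 * (1 + i3) * e1)"
    unfolding x_def y_def using e i3 by algebra
  then have "N2 dvd x * y - 1" using d2 by (simp only: dvd_add dvd_mult dvd_mult2 dvd_refl)
  ultimately have "N dvd x * y - 1" unfolding N using cop by (rule divides_mult)
  then obtain k1 where k1: "x * y = 1 + N * k1" by (metis dvdE eq_diff_eq add.commute)
  have "(3 - x - y) * l - y = w * N1
      + e2 * (5 * (i5 - 9) + (5 + i3) * i5 - (5 + i3) * (i5 - 9) * e2 - 4)"
    unfolding x_def y_def l_def using e i5 by algebra
  then have "N1 dvd (3 - x - y) * l - y" using d1 by (simp only: dvd_add dvd_mult dvd_mult2 dvd_refl)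
  moreover have "(3 - x - y) * l - y = - 3 * v * N2
      + e1 * (- i3 * (9 - i5) - 9 * (5 + i3) + (5 + i3) * (9 - i5) * e1 + 4)"
    unfolding x_def y_def l_def using e i3 by algebra
  then have "N2 dvd (3 - x - y) * l - y" using d2 by (simp only: dvd_add dvd_mult dvd_mult2 dvd_refl)
  ultimately have "N dvd (3 - x - y) * l - y" unfolding N using cop by (rule divides_mult)
  then obtain k2 where k2: "(3 - x - y) * l = y + N * k2" by (metis dvdE eq_diff_eq add.commute)
  have "e1 * e2 = N * (\<alpha> * \<beta>)" by (simp add: e1_def e2_def N)
  then show thesis using that[OF e _ y_def k1 k2] by blast
qed

text \<open>For the word described above, \<open>d^2 - 1\<close> is 4 modulo the part of N prime to
  5 and 4 times the unit \<open>2 * lam + 1\<close> modulo the 5-part; \<open>f\<close> inverts both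
  units at once.\<close>

lemma hk_four_combination:
  fixes N :: int
  assumes "N \<noteq> 0"
  obtains a b c d f g where "hk a b c d" "Zlam_dvd (of_int N) c" "f \<in> Zlam" "g \<in> Zlam"
    "4 = f * (d\<^sup>2 - 1) + of_int N * g"
proof -
  obtain e1 e2 x y l m k1 k2 where *: "e1 + e2 = 1" "e1 * e2 = N * m" "y = 3 * e2 - e1"
    "x * y = 1 + N * k1" "(3 - x - y) * l = y + N * k2"
    using assms by (rule hk_unit_parameters)
  define k3 where "k3 = x * k2 + k1"
  have k3: "(3 - x - y) * l * x = 1 + N * k3"
    unfolding k3_def using *(4,5) by algebra
  define E1 E2 X Y L M K2 K3 n where "E1 = real_of_int e1" and "E2 = real_of_int e2"
    and "X = real_of_int x" and "Y = real_of_int y" and "L = real_of_int l" and "M = real_of_int m"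
    and "K2 = real_of_int k2" and "K3 = real_of_int k3" and "n = real_of_int N"
  note defs = E1_def E2_def X_def Y_def L_def M_def K2_def K3_def n_def
  have E: "E1 + E2 = 1" using *(1) unfolding defs by (metis of_int_1 of_int_add)
  have nM: "E1 * E2 = n * M" using *(2) unfolding defs by (metis of_int_mult)
  have Y: "Y = 3 * E2 - E1" using *(3) unfolding defs by simp
  have kl: "(3 - X - Y) * L = Y + n * K2"
    using arg_cong[OF *(5), of real_of_int] unfolding defs by simp
  have klx: "(3 - X - Y) * L * X = 1 + n * K3"
    using arg_cong[OF k3, of real_of_int] unfolding defs by simp
  have B: "hk (of_int j * lam) (- 1) 1 0" for j :: int
    using hk_mult[OF hk_T[of j] hk_S] by simp
  define c d where "c = (((3 - X - Y) * lam * (L * lam) - 1) * (X * lam) - (3 - X - Y) * lam) * lam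
      - ((3 - X - Y) * lam * (L * lam) - 1)"
    and "d = - (((3 - X - Y) * lam * (L * lam) - 1) * (X * lam) - (3 - X - Y) * lam)"
  have "\<exists>a b. hk a b c d"
  proof -
    have "real_of_int (3 - x - y) = 3 - X - Y" unfolding defs by simp
    then have "hk ((3 - X - Y) * lam) (- 1) 1 0" "hk (L * lam) (- 1) 1 0" "hk (X * lam) (- 1) 1 0" "hk lam (- 1) 1 0"
      using B[of "3 - x - y"] B[of l] B[of x] B[of 1] unfolding defs by simp_all
    note word = hk_mult[OF hk_S hk_mult[OF hk_mult[OF hk_mult[OF this(1,2)] this(3)] this(4)]]
    have "\<exists>a b. hk a b c d" if "hk a b c' d'" "c' = c" "d' = d" for a b c' d'
      using that by blast
    from this[OF word] show ?thesis by (simp add: c_def d_def)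
  qed
  then obtain a b where hk: "hk a b c d" by blast
  have l4: "lam ^ 4 = 3 * lam + 2" and l3: "lam ^ 3 = 2 * lam + 1" and l2: "lam ^ 2 = lam + 1"
    by (simp_all add: power_numeral_reduce lam_simps)
  have "c = (3 - X - Y) * L * X * lam ^ 4 - ((3 - X - Y) * L + (3 - X - Y) + X) * lam ^ 2 + 1"
    unfolding c_def by algebra
  also have "\<dots> = n * (K3 * lam ^ 4 - K2 * lam ^ 2)"
    unfolding klx unfolding kl l4 l2 by (simp add: algebra_simps)
  finally have c: "c = n * (K3 * lam ^ 4 - K2 * lam ^ 2)" .
  have "d = - ((3 - X - Y) * L * X * lam ^ 3 - (3 - Y) * lam)"
    unfolding d_def by algebra
  also have "\<dots> = - ((Y - 1) * lam + 1) - n * (K3 * lam ^ 3)"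
    unfolding klx l3 by (simp add: algebra_simps)
  finally have d: "d = - ((Y - 1) * lam + 1) - n * (K3 * lam ^ 3)" .
  define g where "g = 2 * ((Y - 1) * lam + 1) * (K3 * lam ^ 3) + n * (K3 * lam ^ 3)\<^sup>2"
  have d2: "d\<^sup>2 - 1 = (Y - 1) * lam * ((Y - 1) * lam + 2) + n * g"
    unfolding d g_def by algebra
  \<comment> \<open>The cofactors when the leading part of \<open>d^2 - 1\<close> is expanded around
    \<open>E2 = 0\<close> and around \<open>E1 = 0\<close>.\<close>
  define g1 g2 where "g1 = - 16 * lam\<^sup>2 + 16 * E2 * lam\<^sup>2 + 8 * lam"
    and "g2 = - 16 * lam\<^sup>2 + 16 * E1 * lam\<^sup>2 - 8 * lam"
  have Y1: "Y - 1 = - 2 + 4 * E2" and Y2: "Y - 1 = 2 - 4 * E1" using E Y by simp_all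
  have 1: "(Y - 1) * lam * ((Y - 1) * lam + 2) = 4 + E2 * g1"
    unfolding Y1 g1_def l2 by (simp add: lam_simps)
  have 2: "(Y - 1) * lam * ((Y - 1) * lam + 2) = 4 * (2 * lam + 1) + E1 * g2"
    unfolding Y2 g2_def l2 by (simp add: lam_simps)
  \<comment> \<open>\<open>2 * lam - 3\<close> is the inverse of \<open>2 * lam + 1\<close>.\<close>
  define f where "f = E1 + E2 * (2 * lam - 3)"
  have "(Y - 1) * lam * ((Y - 1) * lam + 2) * f
      = E1 * (4 + E2 * g1) + E2 * (2 * lam - 3) * (4 * (2 * lam + 1) + E1 * g2)"
    unfolding f_def using 1 2 by algebra
  also have "E2 * (2 * lam - 3) * (4 * (2 * lam + 1) + E1 * g2) = 4 * E2 + E2 * (2 * lam - 3) * (E1 * g2)"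
    by (simp add: lam_simps)
  finally have "(Y - 1) * lam * ((Y - 1) * lam + 2) * f = 4 * (E1 + E2) + E1 * E2 * (g1 + (2 * lam - 3) * g2)"
    by (simp add: algebra_simps)
  then have "(Y - 1) * lam * ((Y - 1) * lam + 2) * f = 4 + n * (M * (g1 + (2 * lam - 3) * g2))"
    unfolding E nM by simp
  then have "4 = f * (d\<^sup>2 - 1) + n * (- f * g - M * (g1 + (2 * lam - 3) * g2))"
    unfolding d2 by algebra
  moreover have Z: "E1 \<in> Zlam" "E2 \<in> Zlam" "Y \<in> Zlam" "M \<in> Zlam" "K2 \<in> Zlam" "K3 \<in> Zlam" "n \<in> Zlam"
    unfolding defs by (simp_all add: Zlam_of_int)
  moreover have "f \<in> Zlam" unfolding f_def using Z by (intro Zlam_intros)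
  moreover have "- f * g - M * (g1 + (2 * lam - 3) * g2) \<in> Zlam"
    unfolding g_def g1_def g2_def using Z \<open>f \<in> Zlam\<close> by (intro Zlam_intros)
  moreover have "Zlam_dvd n c" unfolding c using Z by (intro Zlam_dvd_self_mult Zlam_intros)
  ultimately show thesis using that hk unfolding n_def by blast
qed

text \<open>Conjugating T gives the lower left entry \<open>- lam * r^2\<close>, and
  \<open>lam\<close> is a unit. Conjugating the matrix of \<open>hk_four_combination\<close> gives a
  multiple of \<open>r * (1 - d^2)\<close>, and 4 is a combination of \<open>d^2 - 1\<close> and the
  norm of \<tau>.\<close>

lemma normalizes_imp_dvd:
  assumes \<tau>: "\<tau> \<in> Zlam" "\<tau> \<noteq> 0" and hk: "hk p q r s" and norm: "normalizes \<tau> p q r s"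
  shows "Zlam_dvd \<tau> (r\<^sup>2)" "Zlam_dvd \<tau> (4 * r)"
proof -
  note Z = hk_D[OF hk]
  have "g0 \<tau> 1 lam 0 1"
    unfolding g0_def using hk_T1 by (auto simp: Zlam_dvd_def intro: bexI[of _ 0] Zlam_0)
  with norm have "Zlam_dvd \<tau> ((r * 1 + s * 0) * s - (r * lam + s * 1) * r)"
    unfolding normalizes_def g0_def by blast
  from Zlam_dvd_mult_left[OF this, of "1 - lam"]
  have "Zlam_dvd \<tau> ((1 - lam) * ((r * 1 + s * 0) * s - (r * lam + s * 1) * r))"
    by (simp add: Zlam_intros)
  moreover have "(1 - lam) * ((r * 1 + s * 0) * s - (r * lam + s * 1) * r) = r\<^sup>2"
    by (simp add: lam_simps power2_eq_square)
  ultimately show r2: "Zlam_dvd \<tau> (r\<^sup>2)" by simp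
  obtain N :: int where N: "\<tau> * cj \<tau> = of_int N" "N \<noteq> 0" using \<tau> by (rule cj_norm)
  have \<tau>N: "Zlam_dvd \<tau> (of_int N)"
    unfolding N(1)[symmetric] by (intro Zlam_dvd_self_mult cj_in_Zlam)
  obtain a b c d f g where A: "hk a b c d" "Zlam_dvd (of_int N) c" and fg: "f \<in> Zlam" "g \<in> Zlam"
    "4 = f * (d\<^sup>2 - 1) + of_int N * g" using N(2) by (rule hk_four_combination)
  have c: "Zlam_dvd \<tau> c" using \<tau>N A(2) by (rule Zlam_dvd_trans)
  note Z' = hk_D[OF A(1)]
  have "g0 \<tau> a b c d" using A c by (simp add: g0_def)
  with norm have "Zlam_dvd \<tau> ((r * a + s * c) * s - (r * b + s * d) * r)"
    unfolding normalizes_def g0_def by blast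
  \<comment> \<open>Modulo \<open>c\<close> and \<open>r^2\<close> the entry is
    \<open>r * s * (a - d)\<close>; multiplied by \<open>p * d\<close> it becomes
    \<open>r * (1 - d^2)\<close>, as \<open>a * d = 1\<close> modulo \<open>c\<close> and
    \<open>p * s = 1\<close> modulo \<open>r\<close>. The other summands correct this to an
    identity.\<close>
  then have "Zlam_dvd \<tau> (p * d * ((r * a + s * c) * s - (r * b + s * d) * r)
      - (r * b + s * s * p * d) * c + (p * d * b - d * q * (a - d)) * r\<^sup>2)"
    by (rule Zlam_dvd_add[OF Zlam_dvd_diff[OF Zlam_dvd_mult_left Zlam_dvd_mult_left[OF c]]
          Zlam_dvd_mult_left[OF r2]]) (intro Zlam_intros Z Z')+
  moreover have "p * d * ((r * a + s * c) * s - (r * b + s * d) * r)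
      - (r * b + s * s * p * d) * c + (p * d * b - d * q * (a - d)) * r\<^sup>2 = r * (1 - d\<^sup>2)"
    using Z(5) Z'(5) by algebra
  ultimately have rd: "Zlam_dvd \<tau> (r * (1 - d\<^sup>2))" by simp
  have "Zlam_dvd \<tau> (r * g * of_int N - f * (r * (1 - d\<^sup>2)))"
    by (rule Zlam_dvd_diff[OF Zlam_dvd_mult_left[OF \<tau>N] Zlam_dvd_mult_left[OF rd]]) (intro Zlam_intros fg Z)+
  moreover have "r * g * of_int N - f * (r * (1 - d\<^sup>2)) = 4 * r"
    using fg(3) by algebra
  ultimately show "Zlam_dvd \<tau> (4 * r)" by simp
qed

section \<open>The integer h\<close>

lemma largest_h_cases:
  assumes "\<tau> \<in> Zlam"
  shows "largest_h \<tau> = 1 \<and> \<not> Zlam_dvd 4 \<tau>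
    \<or> largest_h \<tau> = 2 \<and> Zlam_dvd 4 \<tau> \<and> \<not> Zlam_dvd 16 \<tau>
    \<or> largest_h \<tau> = 4 \<and> Zlam_dvd 16 \<tau>"
proof -
  define A where "A = {h::nat. h dvd 4 \<and> Zlam_dvd ((of_nat h)\<^sup>2) \<tau>}"
  have dvd4: "h dvd 4 \<longleftrightarrow> h = 1 \<or> h = 2 \<or> h = 4" for h :: nat
  proof
    assume "h dvd 4"
    moreover from this have "h \<le> 4" by (simp add: dvd_imp_le)
    moreover have "\<not> 0 dvd (4::nat)" "\<not> 3 dvd (4::nat)" by simp_all
    moreover have "h = 0 \<or> h = 1 \<or> h = 2 \<or> h = 3 \<or> h = 4" using \<open>h \<le> 4\<close> by linarith
    ultimately show "h = 1 \<or> h = 2 \<or> h = 4" by metis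
  qed auto
  then have A: "A = {h. (h = 1 \<or> h = 2 \<or> h = 4) \<and> Zlam_dvd ((of_nat h)\<^sup>2) \<tau>}" by (simp add: A_def)
  have "finite A" by (rule finite_subset[of _ "{1, 2, 4}"]) (auto simp: A)
  moreover have A1: "1 \<in> A" using assms by (simp add: A Zlam_dvd_1)
  ultimately have "Max A \<in> A" "\<And>h. h \<in> A \<Longrightarrow> h \<le> Max A" by (auto intro: Max_in)
  moreover have A2: "2 \<in> A \<longleftrightarrow> Zlam_dvd 4 \<tau>" and A4: "4 \<in> A \<longleftrightarrow> Zlam_dvd 16 \<tau>" by (simp_all add: A)
  ultimately have "largest_h \<tau> \<in> A" "\<And>h. h \<in> A \<Longrightarrow> h \<le> largest_h \<tau>"
    unfolding largest_h_def A_def by blast+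
  moreover from this(1) have "largest_h \<tau> = 1 \<or> largest_h \<tau> = 2 \<or> largest_h \<tau> = 4" by (simp add: A)
  ultimately show ?thesis using A2 A4 by fastforce
qed

lemma largest_h_dvd:
  assumes "\<tau> \<in> Zlam"
  shows "real (largest_h \<tau>) \<in> {1, 2, 4}" "Zlam_dvd (real (largest_h \<tau>) * real (largest_h \<tau>)) \<tau>"
  using largest_h_cases[OF assms] Zlam_dvd_1[OF assms] by auto

text \<open>From \<open>4 * r = \<tau> * t\<close> and \<open>r^2 = \<tau> * u\<close> follows
  \<open>\<tau> * t^2 = 16 * u\<close>. As 2 is prime, \<open>t\<close> is even unless 16 divides
  \<tau>, and then divisible by 4 unless 4 divides \<tau>; the factor 4 is cancelled
  accordingly.\<close>

lemma dvd_largest_h_mult: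
  assumes \<tau>: "\<tau> \<in> Zlam" "\<tau> \<noteq> 0" and r: "r \<in> Zlam" "Zlam_dvd \<tau> (r\<^sup>2)" "Zlam_dvd \<tau> (4 * r)"
  shows "Zlam_dvd \<tau> (of_nat (largest_h \<tau>) * r)"
proof -
  obtain t where t: "t \<in> Zlam" "4 * r = \<tau> * t" using r(3) unfolding Zlam_dvd_def by blast
  obtain u where u: "u \<in> Zlam" "r\<^sup>2 = \<tau> * u" using r(2) unfolding Zlam_dvd_def by blast
  have "\<tau> * (\<tau> * t\<^sup>2) = (4 * r)\<^sup>2" unfolding t by (simp add: power2_eq_square)
  also have "\<dots> = \<tau> * (16 * u)" by (simp add: power_mult_distrib u)
  finally have key: "\<tau> * t\<^sup>2 = 16 * u" using \<tau>(2) by simp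
  have odd: "Zlam_dvd (2 ^ n) x" if "x \<in> Zlam" "t \<in> Zlam" "\<not> Zlam_dvd 2 t" "Zlam_dvd (2 ^ n) (x * t\<^sup>2)" for n x t
    using that
  proof (induction n arbitrary: x)
    case 0
    then show ?case by (simp add: Zlam_dvd_1)
  next
    case (Suc n)
    then have "Zlam_dvd 2 (x * t\<^sup>2)"
      using Zlam_dvd_trans[of 2 "2 ^ Suc n"] Zlam_dvd_self_mult[of "2 ^ n" 2] by (simp add: Zlam_intros)
    then have "Zlam_dvd 2 x"
      using two_prime[of x "t\<^sup>2"] two_prime[of t t] Suc.prems by (auto simp: Zlam_intros power2_eq_square)
    then obtain z where z: "z \<in> Zlam" "x = 2 * z" unfolding Zlam_dvd_def by blast
    have "Zlam_dvd (2 ^ n) (z * t\<^sup>2)"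
      using Suc.prems(4) Zlam_dvd_mult_cancel[of 2 "2 ^ n" "z * t\<^sup>2"] unfolding z by (simp add: mult.assoc)
    then have "Zlam_dvd (2 ^ n) z" using Suc z by blast
    then show ?case unfolding z using Zlam_dvd_mult_cancel[of 2 "2 ^ n" z] by simp
  qed
  have even_t: "Zlam_dvd 2 t" if "\<not> Zlam_dvd 16 \<tau>"
    using odd[of \<tau> t 4] that \<tau>(1) t(1) u(1) unfolding key by (auto intro: Zlam_dvd_self_mult)
  from largest_h_cases[OF \<tau>(1)] show ?thesis
  proof (elim disjE conjE)
    assume h: "largest_h \<tau> = 4"
    show ?thesis using r(3) by (simp add: h)
  next
    assume h: "largest_h \<tau> = 2" and "\<not> Zlam_dvd 16 \<tau>"
    then obtain z where z: "z \<in> Zlam" "t = 2 * z" using even_t unfolding Zlam_dvd_def by blast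
    have "2 * r = \<tau> * z" using t(2) unfolding z by simp
    then show ?thesis unfolding h using z by (auto intro: Zlam_dvd_self_mult)
  next
    assume h: "largest_h \<tau> = 1" and n4: "\<not> Zlam_dvd 4 \<tau>"
    have "Zlam_dvd 4 (16::real)" using Zlam_dvd_self_mult[of 4 4] by (simp add: Zlam_numeral)
    then have "\<not> Zlam_dvd 16 \<tau>" using n4 Zlam_dvd_trans by blast
    then obtain z where z: "z \<in> Zlam" "t = 2 * z" using even_t unfolding Zlam_dvd_def by blast
    have "\<tau> * z\<^sup>2 = 4 * u" using key unfolding z by (simp add: power_mult_distrib)
    then have "Zlam_dvd 2 z"
      using odd[of \<tau> z 2] n4 \<tau>(1) z(1) u(1) by (auto intro: Zlam_dvd_self_mult)
    then obtain z' where z': "z' \<in> Zlam" "z = 2 * z'" unfolding Zlam_dvd_def by blast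
    have "r = \<tau> * z'" using t(2) unfolding z z' by simp
    then show ?thesis unfolding h using z' by (auto intro: Zlam_dvd_self_mult)
  qed
qed

section \<open>The normaliser and its quotient\<close>

theorem normalizer_G0:
  assumes \<tau>: "\<tau> \<in> Zlam" "\<tau> \<noteq> 0"
  shows "normalizer PSL2R (G0 \<tau>) = G0 (\<tau> / of_nat (largest_h \<tau>))"
proof -
  define h where "h = real (largest_h \<tau>)"
  have h: "h \<in> {1, 2, 4}" "Zlam_dvd (h * h) \<tau>" using largest_h_dvd[OF \<tau>(1)] by (simp_all add: h_def)
  have h0: "h \<noteq> 0" "h \<in> Zlam" using h(1) by (auto simp: Zlam_numeral Zlam_1)
  have "normalizer PSL2R (G0 \<tau>) = G0 (\<tau> / h)"
  proof (intro equalityI subsetI)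
    fix X assume X: "X \<in> normalizer PSL2R (G0 \<tau>)"
    then have "X \<in> carrier PSL2R" unfolding normalizer_def stabilizer_def by simp
    then obtain A where A: "X = psl_class A" "det A = 1" by (auto simp: carrier_PSL2R)
    then obtain p q r s where pqrs: "X = psl_class (mat2 p q r s)" "p * s - q * r = 1"
      using mat2_surj[of A] det_mat2 by metis
    then have N: "normalizes \<tau> p q r s" "normalizes \<tau> s (- q) (- r) p"
      using X mem_normalizer_G0_iff by blast+
    have hk: "hk p q r s" by (rule normalizes_imp_hk[OF \<tau> pqrs(2) N])
    have "Zlam_dvd \<tau> (h * r)"
      unfolding h_def using normalizes_imp_dvd[OF \<tau> hk N(1)] hk_D[OF hk]
      by (intro dvd_largest_h_mult \<tau>)
    then have "Zlam_dvd (\<tau> / h) r"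
      using Zlam_dvd_mult_cancel[of h "\<tau> / h" r] h0 by simp
    then show "X \<in> G0 (\<tau> / h)" unfolding pqrs psl_class_mat2_in_G0 using hk by (simp add: g0_def)
  next
    fix X assume "X \<in> G0 (\<tau> / h)"
    then obtain p q r s where X: "X = psl_class (mat2 p q r s)" and g: "g0 (\<tau> / h) p q r s"
      by (rule G0_cases)
    then have hk: "hk p q r s" and r: "Zlam_dvd (\<tau> / h) r" by (auto simp: g0_def)
    \<comment> \<open>That \<open>h^2\<close> divides \<tau> is exactly the hypothesis of
      \<open>hk_normalizes\<close> with \<open>\<tau> / h\<close> for
      \<open>\<tau>'\<close>.\<close>
    have d: "Zlam_dvd h (\<tau> / h)" using h(2) h0 Zlam_dvd_mult_cancel[of h h "\<tau> / h"] by simp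
    then have Z: "\<tau> / h \<in> Zlam" using h0 Zlam_dvd_imp_Zlam by blast
    have "normalizes (h * (\<tau> / h)) p q r s" "normalizes (h * (\<tau> / h)) s (- q) (- r) p"
      using r by (intro hk_normalizes hk hk_inv[OF hk] h d Z; simp add: Zlam_dvd_minus)+
    then show "X \<in> normalizer PSL2R (G0 \<tau>)"
      unfolding X mem_normalizer_G0_iff[OF hk_D(5)[OF hk]] using h0 by simp
  qed
  then show ?thesis by (simp add: h_def)
qed

text \<open>Reduction modulo h, with the residue ring identified additively with pairs through the
  basis 1, \<open>lam\<close>.\<close>

definition residue :: "nat \<Rightarrow> real \<Rightarrow> int \<times> int" where
  "residue h x = (fst (coords x) mod int h, snd (coords x) mod int h)"

lemma residue_eq: "residue h (of_int a + of_int b * lam) = (a mod int h, b mod int h)"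
  by (simp add: residue_def)

lemma residue_eq_iff:
  assumes "x \<in> Zlam" "y \<in> Zlam"
  shows "residue h x = residue h y \<longleftrightarrow> Zlam_dvd (real h) (x - y)"
proof -
  obtain a b where x: "x = of_int a + of_int b * lam" using assms(1) by (rule Zlam_cases)
  obtain c d where y: "y = of_int c + of_int d * lam" using assms(2) by (rule Zlam_cases)
  have "x - y = of_int (a - c) + of_int (b - d) * lam" unfolding x y by (simp add: algebra_simps)
  then have "Zlam_dvd (real h) (x - y) \<longleftrightarrow> int h dvd a - c \<and> int h dvd b - d"
    using Zlam_dvd_of_int_coords[of "int h"] by (simp only: of_int_of_nat_eq)
  then show ?thesis unfolding x y residue_eq by (simp add: mod_eq_dvd_iff)
qed

lemma residue_add:
  assumes "x \<in> Zlam" "y \<in> Zlam"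
  shows "residue h (x + y) = residue h x \<otimes>\<^bsub>integer_mod_group h \<times>\<times> integer_mod_group h\<^esub> residue h y"
proof -
  obtain a b where x: "x = of_int a + of_int b * lam" using assms(1) by (rule Zlam_cases)
  obtain c d where y: "y = of_int c + of_int d * lam" using assms(2) by (rule Zlam_cases)
  have "x + y = of_int (a + c) + of_int (b + d) * lam" unfolding x y by (simp add: algebra_simps)
  then show ?thesis unfolding x y by (simp only: residue_eq) (simp add: mod_add_eq)
qed

text \<open>The homomorphism onto \<open>\<int>[\<lambda>]/h\<close> with kernel \<open>G\<^sub>0(h \<tau>')\<close> is \<open>c d / \<tau>'\<close>, where \<open>(c, d)\<close> is the lower row; it
  does not depend on the sign of the representing matrix.\<close>

definition lower_residue :: "nat \<Rightarrow> real \<Rightarrow> (real^2^2) set \<Rightarrow> int \<times> int" where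
  "lower_residue h \<tau>' X = (let A = (SOME A. A \<in> X) in residue h (A $ 2 $ 1 * A $ 2 $ 2 / \<tau>'))"

lemma lower_residue_eq:
  "lower_residue h \<tau>' (psl_class (mat2 a b c d)) = residue h (c * d / \<tau>')"
proof -
  have "(SOME A. A \<in> psl_class (mat2 a b c d)) \<in> psl_class (mat2 a b c d)"
    by (rule someI[of _ "mat2 a b c d"]) (simp add: psl_class_eq)
  then show ?thesis by (auto simp: lower_residue_def psl_class_eq mat2_minus Let_def)
qed

text \<open>The first isomorphism theorem for \<open>lower_residue\<close>. Additivity and the
  kernel rest on \<open>d^2 = 1\<close> modulo h, surjectivity on the theorem about cusps.\<close>

lemma quotient_G0:
  assumes \<tau>': "\<tau>' \<in> Zlam" "\<tau>' \<noteq> 0" and h: "real h \<in> {1, 2, 4}" and dvd: "Zlam_dvd (real h) \<tau>'"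
  shows "(PSL2R\<lparr>carrier := G0 \<tau>'\<rparr>) Mod (G0 (real h * \<tau>')) \<cong> integer_mod_group h \<times>\<times> integer_mod_group h"
proof -
  let ?G = "PSL2R\<lparr>carrier := G0 \<tau>'\<rparr>" and ?H = "integer_mod_group h \<times>\<times> integer_mod_group h"
  have h0: "h > 0" using h by auto
  have lower: "\<exists>x\<in>Zlam. c = \<tau>' * x" if "g0 \<tau>' a b c d" for a b c d
    using that unfolding g0_def Zlam_dvd_def by blast
  have square: "Zlam_dvd (real h) (d\<^sup>2 - 1)" if "g0 \<tau>' a b c d" for a b c d
    using that Zlam_dvd_trans[OF dvd] unfolding g0_def by (intro hk_square_mod[OF _ h]) auto
  have carr: "residue h x \<in> carrier ?H" for x
    using h0 by (simp add: residue_def carrier_integer_mod_group)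
  have hom: "lower_residue h \<tau>' \<in> hom ?G ?H"
  proof (rule homI)
    fix X assume "X \<in> carrier ?G"
    then show "lower_residue h \<tau>' X \<in> carrier ?H"
      by (simp only: lower_residue_def Let_def carr)
  next
    fix X1 X2 assume "X1 \<in> carrier ?G" "X2 \<in> carrier ?G"
    then have "X1 \<in> G0 \<tau>'" "X2 \<in> G0 \<tau>'" by simp_all
    then obtain a1 b1 c1 d1 a2 b2 c2 d2 where
      X1: "X1 = psl_class (mat2 a1 b1 c1 d1)" and g1: "g0 \<tau>' a1 b1 c1 d1" and
      X2: "X2 = psl_class (mat2 a2 b2 c2 d2)" and g2: "g0 \<tau>' a2 b2 c2 d2"
      by (metis G0_cases)
    obtain x1 where x1: "x1 \<in> Zlam" "c1 = \<tau>' * x1" using lower[OF g1] by blast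
    obtain x2 where x2: "x2 \<in> Zlam" "c2 = \<tau>' * x2" using lower[OF g2] by blast
    have Z: "a1 \<in> Zlam" "b1 \<in> Zlam" "d1 \<in> Zlam" "a2 \<in> Zlam" "b2 \<in> Zlam" "d2 \<in> Zlam"
      using g1 g2 hk_D unfolding g0_def by blast+
    define P where "P = (c1 * a2 + d1 * c2) * (c1 * b2 + d1 * d2) / \<tau>'"
    have P: "P = (x1 * a2 + d1 * x2) * (\<tau>' * x1 * b2 + d1 * d2)"
      unfolding P_def x1 x2 using \<tau>'(2) by (simp add: field_simps)
    have PZ: "P \<in> Zlam" unfolding P using Z x1 x2 \<tau>' by (intro Zlam_intros)
    \<comment> \<open>Every error term contains \<open>\<tau>'\<close>, a multiple of h, or
      \<open>d1^2 - 1\<close>.\<close>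
    have "P - (x1 * d1 + x2 * d2) = (x1 * b2 * (x1 * a2 + d1 * x2) + x1 * d1 * b2 * x2) * \<tau>'
        + x2 * d2 * (d1\<^sup>2 - 1)"
      unfolding P using g0_det[OF g2, unfolded x2(2)] by algebra
    also have "Zlam_dvd (real h) \<dots>"
      using dvd square[OF g1] Z x1 x2 by (intro Zlam_dvd_add Zlam_dvd_mult_left Zlam_intros)
    finally have "residue h P = residue h (x1 * d1 + x2 * d2)"
      using residue_eq_iff[OF PZ] Z x1 x2 by (simp add: Zlam_intros)
    moreover have "lower_residue h \<tau>' (X1 \<otimes>\<^bsub>?G\<^esub> X2) = residue h P"
      using g0_det[OF g1] g0_det[OF g2]
      by (simp add: X1 X2 psl_class_mat2_mult lower_residue_eq P_def)
    moreover have "lower_residue h \<tau>' X1 = residue h (x1 * d1)" "lower_residue h \<tau>' X2 = residue h (x2 * d2)"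
      unfolding X1 X2 lower_residue_eq x1 x2 using \<tau>'(2) by (simp_all add: mult.assoc)
    ultimately show "lower_residue h \<tau>' (X1 \<otimes>\<^bsub>?G\<^esub> X2)
        = lower_residue h \<tau>' X1 \<otimes>\<^bsub>?H\<^esub> lower_residue h \<tau>' X2"
      using residue_add[of "x1 * d1" "x2 * d2" h] Z x1 x2 by (simp only: Zlam_mult)
  qed
  have group_G: "group ?G"
    by (rule subgroup.subgroup_is_group[OF subgroup_G0 group_PSL2R])
  have group_H: "group ?H" by (simp add: DirProd_group)
  interpret \<phi>: group_hom ?G ?H "lower_residue h \<tau>'"
    using group_G group_H hom by (simp add: group_hom_def group_hom_axioms_def)
  have surj: "lower_residue h \<tau>' ` carrier ?G = carrier ?H"
  proof
    show "lower_residue h \<tau>' ` carrier ?G \<subseteq> carrier ?H" using hom by (rule hom_carrier)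
    show "carrier ?H \<subseteq> lower_residue h \<tau>' ` carrier ?G"
    proof
      fix z assume "z \<in> carrier ?H"
      then obtain i j where z: "z = (i, j)" "0 \<le> i" "i < int h" "0 \<le> j" "j < int h"
        using h0 by (auto simp: carrier_integer_mod_group)
      define x where "x = of_int i + of_int j * lam"
      have x: "x \<in> Zlam" unfolding x_def by (intro Zlam_intros)
      have zx: "z = residue h x" unfolding x_def residue_eq using z by simp
      \<comment> \<open>An orbit vector in the direction of (1, \<tau>' x) has
        \<open>w = \<tau>' * x * u\<close>; its residue is that of \<open>x * u * d\<close>, and
        \<open>u * d = 1 + b * w\<close> is 1 modulo h.\<close>
      obtain k u w where kuw: "Lam u w" "1 = k * u" "\<tau>' * x = k * w"
        using cusps[OF Zlam_1 Zlam_mult[OF \<tau>'(1) x]] by blast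
      obtain b d where hk: "hk u b w d" using kuw(1) unfolding Lam_def by blast
      note Z = hk_D[OF hk]
      have "w = k * u * w" using kuw(2) by simp
      also have "\<dots> = \<tau>' * (x * u)" using kuw(3) by (simp add: mult_ac)
      finally have w: "w = \<tau>' * (x * u)" .
      have g: "g0 \<tau>' u b w d"
        unfolding g0_def using hk x Z unfolding w by (auto intro!: Zlam_dvd_self_mult Zlam_intros)
      have eq: "w * d / \<tau>' = x * u * d" unfolding w using \<tau>'(2) by simp
      have "x * u * d - x = x * b * (x * u) * \<tau>'" using Z(5) unfolding w by algebra
      then have "Zlam_dvd (real h) (x * u * d - x)"
        using dvd x Z by (auto intro!: Zlam_dvd_mult_left Zlam_intros)
      then have "residue h (x * u * d) = residue h x"
        using x Z by (subst residue_eq_iff) (auto intro!: Zlam_intros)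
      then have "lower_residue h \<tau>' (psl_class (mat2 u b w d)) = z"
        unfolding lower_residue_eq eq zx .
      then show "z \<in> lower_residue h \<tau>' ` carrier ?G"
        using g unfolding psl_class_mat2_in_G0[symmetric] by force
    qed
  qed
  have "kernel ?G ?H (lower_residue h \<tau>') = G0 (real h * \<tau>')"
  proof -
    have eq: "lower_residue h \<tau>' (psl_class (mat2 a b c d)) = \<one>\<^bsub>?H\<^esub> \<longleftrightarrow> Zlam_dvd (real h * \<tau>') c"
      if g: "g0 \<tau>' a b c d" for a b c d
    proof -
      obtain x where x: "x \<in> Zlam" "c = \<tau>' * x" using lower[OF g] by blast
      have d: "d \<in> Zlam" using g hk_D(4) unfolding g0_def by blast
      have one: "\<one>\<^bsub>?H\<^esub> = residue h 0"
        using residue_eq[of h 0 0] by simp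
      have "lower_residue h \<tau>' (psl_class (mat2 a b c d)) = residue h (x * d)"
        unfolding lower_residue_eq x using \<tau>'(2) by (simp add: mult.assoc)
      also have "\<dots> = \<one>\<^bsub>?H\<^esub> \<longleftrightarrow> Zlam_dvd (real h) (x * d)"
        unfolding one using residue_eq_iff[OF Zlam_mult[OF x(1) d] Zlam_0] by simp
      also have "\<dots> \<longleftrightarrow> Zlam_dvd (real h) x"
      proof
        assume "Zlam_dvd (real h) (x * d)"
        \<comment> \<open>\<open>d\<close> is its own inverse modulo h; the combination equals
          \<open>x\<close>.\<close>
        then have "Zlam_dvd (real h) (d * (x * d) - x * (d\<^sup>2 - 1))"
          by (rule Zlam_dvd_diff[OF Zlam_dvd_mult_left Zlam_dvd_mult_left[OF square[OF g] x(1)]]) (rule d)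
        then show "Zlam_dvd (real h) x" by (simp add: algebra_simps power2_eq_square)
      qed (use d Zlam_dvd_mult in blast)
      also have "\<dots> \<longleftrightarrow> Zlam_dvd (real h * \<tau>') c"
        unfolding x using Zlam_dvd_mult_cancel[OF \<tau>'(2), of "real h" x] by (simp add: mult.commute)
      finally show ?thesis .
    qed
    have sub: "g0 \<tau>' a b c d" if "g0 (real h * \<tau>') a b c d" for a b c d
      using that Zlam_dvd_trans[of \<tau>' "real h * \<tau>'" c] Zlam_dvd_self_mult[of "real h" \<tau>']
      unfolding g0_def by (simp add: Zlam_of_nat mult.commute)
    show ?thesis
    proof (intro equalityI subsetI)
      fix X assume "X \<in> kernel ?G ?H (lower_residue h \<tau>')"
      then have X: "X \<in> G0 \<tau>'" "lower_residue h \<tau>' X = \<one>\<^bsub>?H\<^esub>" by (auto simp: kernel_def)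
      from X(1) obtain a b c d where "X = psl_class (mat2 a b c d)" "g0 \<tau>' a b c d" by (rule G0_cases)
      with X(2) eq show "X \<in> G0 (real h * \<tau>')"
        by (auto simp: psl_class_mat2_in_G0) (auto simp: g0_def)
    next
      fix X assume "X \<in> G0 (real h * \<tau>')"
      then obtain a b c d where X: "X = psl_class (mat2 a b c d)" "g0 (real h * \<tau>') a b c d" by (rule G0_cases)
      then have "lower_residue h \<tau>' X = \<one>\<^bsub>?H\<^esub>" using eq[OF sub[OF X(2)]] by (auto simp: g0_def)
      then show "X \<in> kernel ?G ?H (lower_residue h \<tau>')"
        using sub[OF X(2)] X(1) by (simp add: kernel_def psl_class_mat2_in_G0)
    qed
  qed
  then show ?thesis using \<phi>.FactGroup_iso[OF surj] by simp
qed

theorem mainTheorem1: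
  fixes \<tau> :: real and h :: nat
  assumes "\<tau> \<in> Zlam" and "\<tau> \<noteq> 0"
    and "h = largest_h \<tau>"
  shows "normalizer PSL2R (G0 \<tau>) = G0 (\<tau> / of_nat h) \<and>
    (h = 1 \<longrightarrow> trivial_group (normalizer_quotient \<tau>)) \<and>
    (h = 2 \<longrightarrow> normalizer_quotient \<tau> \<cong> integer_mod_group 2 \<times>\<times> integer_mod_group 2) \<and>
    (h = 4 \<longrightarrow> normalizer_quotient \<tau> \<cong> integer_mod_group 4 \<times>\<times> integer_mod_group 4)"
proof -
  have N: "normalizer PSL2R (G0 \<tau>) = G0 (\<tau> / of_nat h)"
    unfolding assms(3) using assms(1,2) by (rule normalizer_G0)
  have h: "real h \<in> {1, 2, 4}" "Zlam_dvd (real h * real h) \<tau>"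
    using largest_h_dvd[OF assms(1)] assms(3) by simp_all
  then have h0: "real h \<noteq> 0" by auto
  have dvd: "Zlam_dvd (real h) (\<tau> / real h)"
    using h(2) h0 Zlam_dvd_mult_cancel[of "real h" "real h" "\<tau> / real h"] by simp
  have "\<tau> / real h \<in> Zlam" "\<tau> / real h \<noteq> 0"
    using Zlam_dvd_imp_Zlam[OF dvd Zlam_of_nat] assms(2) h0 by auto
  \<comment> \<open>One isomorphism serves all three values of h; for h = 1 its target is
    trivial.\<close>
  from quotient_G0[OF this h(1) dvd] have iso:
    "normalizer_quotient \<tau> \<cong> integer_mod_group h \<times>\<times> integer_mod_group h"
    unfolding normalizer_quotient_def N using h0 by simp
  have "trivial_group (normalizer_quotient \<tau>)" if "h = 1"
  proof -
    have "group (normalizer_quotient \<tau>)"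
      unfolding normalizer_quotient_def
      by (rule normal.factorgroup_is_group[OF G0_normal_in_normalizer])
    moreover have "trivial_group (integer_mod_group 1 \<times>\<times> integer_mod_group 1)"
      by (auto simp: trivial_group_def DirProd_group carrier_integer_mod_group)
    ultimately show ?thesis
      using iso that isomorphic_group_triviality by (metis DirProd_group group_integer_mod_group)
  qed
  with N iso show ?thesis by blast
qed

end
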